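(* Let $\mathcal{T}$ be a tree on $k$ vertices, and let $G$ be a chain of connected graphs $G_1,\dots,G_k$ with respect to $\mathcal{T}$, where $G$ has at least one edge. Then $$\kappa(G)=\sum_{i=1}^{k}\frac{m_{G_i}}{m_G}\kappa(G_i)+\sum_{x\sim y\in\mathcal{B}_G}\left(\frac{\overline{W}_x}{m_G}\mathbf{d}_{G_x}^TR_{G_x}\mathbf{e}_x+\frac{\overline{W}_y}{m_G}\mathbf{d}_{G_y}^TR_{G_y}\mathbf{e}_y\right)+\sum_{i=1}^{k}\sum_{(z_1,z_2)\in\widetilde{V}_i\times\widetilde{V}_i}\frac{\overline{W}_{z_1}\overline{W}_{z_2}}{m_G}r^{G_i}_{z_1,z_2}+\sum_{x\sim y\in\mathcal{B}_G}\frac{(2\overline{W}_x-1)(2\overline{W}_y-1)}{2m_G}.$$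
   Context: All graphs are finite, simple and undirected. For a graph $H$: $m_H$ is the number of edges; $\mathbf{d}_H$ is the column vector of vertex degrees; $\mathbf{e}_v$ is the standard basis vector indexed by the vertex $v$. For connected $H$, $R_H=[r^H_{u,v}]$ is the effective resistance matrix, $r^H_{u,v}=(\mathbf{e}_u-\mathbf{e}_v)^TL^\dagger(\mathbf{e}_u-\mathbf{e}_v)$ with $L^\dagger$ the Moore–Penrose inverse of the Laplacian matrix of $H$. Kemeny's constant $\kappa(H)$ of a connected graph $H$ is that of the simple random walk on $H$ (from a vertex, move to a uniformly random neighbour): $\kappa(H)=\sum_{j\neq i}\pi_j m_{i,j}$, where $\pi_j=\deg_H(j)/(2m_H)$ is the stationary distribution and $m_{i,j}$ is the mean first passage time from $i$ to $j$; it does not depend on the choice of $i$. For a graph with at least one edge, $\kappa(H)=\mathbf{d}_H^TR_H\mathbf{d}_H/(4m_H)$. For a single-vertex graph, $\kappa(H)=0$ (empty sum). Chain: let $\mathcal{T}$ be a tree with vertex set $\{1,\dots,k\}$ and $G_1,\dots,G_k$ connected graphs (on disjoint vertex sets). A chain of $G_1,\dots,G_k$ with respect to $\mathcal{T}$ is a graph $G$ obtained from the disjoint union of $G_1,\dots,G_k$ by choosing, for each edge $i\sim j$ of $\mathcal{T}$, some vertex $v_i\in V(G_i)$ and some vertex $v_j\in V(G_j)$ and adding the edge $v_i\sim v_j$ (the choices for different edges of $\mathcal{T}$ are independent; the same vertex may be chosen several times). $\mathcal{B}_G$ is the set of the $k-1$ added edges; each is a bridge of $G$. For a vertex $z$ of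 $G$, $G_z$ denotes the graph $G_j$ with $z\in V(G_j)$. $\widetilde{V}_i$ is the collection of ends in $V(G_i)$ of bridges in $\mathcal{B}_G$, one element for each bridge in $\mathcal{B}_G$ having an end in $G_i$; so $|\widetilde{V}_i|=\deg_{\mathcal{T}}(i)$, and a vertex incident to several bridges of $\mathcal{B}_G$ occurs once for each of them. For an end $x$ of a bridge $x\sim y\in\mathcal{B}_G$, $W_x$ is the number of edges of the component containing $x$ of $G$ with the edge $x\sim y$ removed, and $\overline{W}_x=m_G-W_x$ (so these numbers depend on the end together with its bridge); in particular $\overline{W}_x=W_y+1$. *)

theory Defs
  imports "HOL-Probability.Probability_Mass_Function" "HOL-Library.Disjoint_Sets"
begin

record 'a ugraph =
  verts :: "'a set"
  edges :: "'a set set"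

definition simple_graph :: "'a ugraph \<Rightarrow> bool" where
  "simple_graph H \<longleftrightarrow> finite (verts H) \<and>
     edges H \<subseteq> {{u, v} | u v. u \<in> verts H \<and> v \<in> verts H \<and> u \<noteq> v}"

definition num_edges :: "'a ugraph \<Rightarrow> nat" where
  "num_edges H = card (edges H)"

definition neighbours :: "'a ugraph \<Rightarrow> 'a \<Rightarrow> 'a set" where
  "neighbours H u = {v. {u, v} \<in> edges H}"

definition degree :: "'a ugraph \<Rightarrow> 'a \<Rightarrow> nat" where
  "degree H u = card (neighbours H u)"

definition reachable :: "'a ugraph \<Rightarrow> 'a \<Rightarrow> 'a \<Rightarrow> bool" where
  "reachable H u v \<longleftrightarrow> (u, v) \<in> {(a, b). {a, b} \<in> edges H}\<^sup>*"

definition connected_graph :: "'a ugraph \<Rightarrow> bool" where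
  "connected_graph H \<longleftrightarrow> simple_graph H \<and> verts H \<noteq> {} \<and>
     (\<forall>u \<in> verts H. \<forall>v \<in> verts H. reachable H u v)"

definition is_cycle :: "'a ugraph \<Rightarrow> 'a list \<Rightarrow> bool" where
  "is_cycle H p \<longleftrightarrow> 3 \<le> length p \<and> distinct p \<and>
     (\<forall>i < length p. {p ! i, p ! (Suc i mod length p)} \<in> edges H)"

definition tree_graph :: "'a ugraph \<Rightarrow> bool" where
  "tree_graph H \<longleftrightarrow> connected_graph H \<and> \<not> (\<exists>p. is_cycle H p)"

definition delete_edge :: "'a ugraph \<Rightarrow> 'a set \<Rightarrow> 'a ugraph" where
  "delete_edge H b = H\<lparr>edges := edges H - {b}\<rparr>"

definition component_of :: "'a ugraph \<Rightarrow> 'a \<Rightarrow> 'a ugraph" where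
  "component_of H x =
     \<lparr>verts = {v \<in> verts H. reachable H x v},
      edges = {e \<in> edges H. \<forall>v \<in> e. reachable H x v}\<rparr>"

text \<open>Vectors and matrices indexed by the vertex set \<open>V\<close> of a graph are functions on the ambient
  vertex type; all sums range over \<open>V\<close>.\<close>

definition inner_on :: "'a set \<Rightarrow> ('a \<Rightarrow> real) \<Rightarrow> ('a \<Rightarrow> real) \<Rightarrow> real" where
  "inner_on V x y = (\<Sum>u\<in>V. x u * y u)"

definition mat_vec_on :: "'a set \<Rightarrow> ('a \<Rightarrow> 'a \<Rightarrow> real) \<Rightarrow> ('a \<Rightarrow> real) \<Rightarrow> 'a \<Rightarrow> real" where
  "mat_vec_on V A x = (\<lambda>u. \<Sum>w\<in>V. A u w * x w)"

definition mat_mult_on ::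
    "'a set \<Rightarrow> ('a \<Rightarrow> 'a \<Rightarrow> real) \<Rightarrow> ('a \<Rightarrow> 'a \<Rightarrow> real) \<Rightarrow> 'a \<Rightarrow> 'a \<Rightarrow> real" where
  "mat_mult_on V A B = (\<lambda>u v. \<Sum>w\<in>V. A u w * B w v)"

definition unit_vec :: "'a \<Rightarrow> 'a \<Rightarrow> real" where
  "unit_vec v = (\<lambda>u. if u = v then 1 else 0)"

definition degree_vec :: "'a ugraph \<Rightarrow> 'a \<Rightarrow> real" where
  "degree_vec H = (\<lambda>u. real (degree H u))"

text \<open>The four Penrose conditions.  The last conjunct only normalises the irrelevant values outside
  \<open>V \<times> V\<close>, so that the inverse is unique as a function.\<close>

definition is_MP_inverse_on ::
    "'a set \<Rightarrow> ('a \<Rightarrow> 'a \<Rightarrow> real) \<Rightarrow> ('a \<Rightarrow> 'a \<Rightarrow> real) \<Rightarrow> bool" where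
  "is_MP_inverse_on V A X \<longleftrightarrow>
     (\<forall>u\<in>V. \<forall>v\<in>V.
        mat_mult_on V (mat_mult_on V A X) A u v = A u v \<and>
        mat_mult_on V (mat_mult_on V X A) X u v = X u v \<and>
        mat_mult_on V A X u v = mat_mult_on V A X v u \<and>
        mat_mult_on V X A u v = mat_mult_on V X A v u) \<and>
     (\<forall>u v. u \<notin> V \<or> v \<notin> V \<longrightarrow> X u v = 0)"

definition MP_inverse_on :: "'a set \<Rightarrow> ('a \<Rightarrow> 'a \<Rightarrow> real) \<Rightarrow> 'a \<Rightarrow> 'a \<Rightarrow> real" where
  "MP_inverse_on V A = (THE X. is_MP_inverse_on V A X)"

definition laplacian :: "'a ugraph \<Rightarrow> 'a \<Rightarrow> 'a \<Rightarrow> real" where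
  "laplacian H u v =
     (if u = v then real (degree H u) else if {u, v} \<in> edges H then - 1 else 0)"

definition resistance :: "'a ugraph \<Rightarrow> 'a \<Rightarrow> 'a \<Rightarrow> real" where
  "resistance H u v =
     (let x = (\<lambda>w. unit_vec u w - unit_vec v w)
      in inner_on (verts H) x (mat_vec_on (verts H) (MP_inverse_on (verts H) (laplacian H)) x))"

text \<open>The law of the first \<open>n + 1\<close> positions of the simple random walk started at \<open>i\<close>.
  It is meaningful when no vertex reachable from \<open>i\<close> is isolated.\<close>

primrec walk_pmf :: "'a ugraph \<Rightarrow> nat \<Rightarrow> 'a \<Rightarrow> 'a list pmf" where
  "walk_pmf H 0 i = return_pmf [i]"
| "walk_pmf H (Suc n) i =
     bind_pmf (pmf_of_set (neighbours H i)) (\<lambda>u. map_pmf ((#) i) (walk_pmf H n u))"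

definition first_passage_prob :: "'a ugraph \<Rightarrow> 'a \<Rightarrow> 'a \<Rightarrow> nat \<Rightarrow> real" where
  "first_passage_prob H i j n =
     measure_pmf.prob (walk_pmf H n i) {p. p ! n = j \<and> (\<forall>t. 1 \<le> t \<and> t < n \<longrightarrow> p ! t \<noteq> j)}"

text \<open>Expectation of the first passage time.  On a finite connected graph the first passage time
  is almost surely finite, with geometrically decaying tails, so the series converges.\<close>

definition mean_first_passage :: "'a ugraph \<Rightarrow> 'a \<Rightarrow> 'a \<Rightarrow> real" where
  "mean_first_passage H i j = (\<Sum>n. real n * first_passage_prob H i j n)"

definition stationary :: "'a ugraph \<Rightarrow> 'a \<Rightarrow> real" where
  "stationary H j = real (degree H j) / (2 * real (num_edges H))"

text \<open>The common value, over all starting vertices \<open>i\<close>, of the weighted mean first passage times.\<close>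

definition kemeny :: "'a ugraph \<Rightarrow> real" where
  "kemeny H =
     (THE c. \<forall>i \<in> verts H. (\<Sum>j \<in> verts H - {i}. stationary H j * mean_first_passage H i j) = c)"

text \<open>For an edge \<open>{i, j}\<close> of the tree \<open>T\<close>, \<open>att i j\<close> is the vertex chosen in \<open>Gs i\<close> and
  \<open>att j i\<close> the vertex chosen in \<open>Gs j\<close>.\<close>

definition chain_bridges :: "'i ugraph \<Rightarrow> ('i \<Rightarrow> 'i \<Rightarrow> 'a) \<Rightarrow> 'a set set" where
  "chain_bridges T att = {{att i j, att j i} | i j. {i, j} \<in> edges T}"

definition is_chain ::
    "'i ugraph \<Rightarrow> ('i \<Rightarrow> 'a ugraph) \<Rightarrow> ('i \<Rightarrow> 'i \<Rightarrow> 'a) \<Rightarrow> 'a ugraph \<Rightarrow> bool" where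
  "is_chain T Gs att G \<longleftrightarrow>
     disjoint_family_on (\<lambda>i. verts (Gs i)) (verts T) \<and>
     (\<forall>i j. {i, j} \<in> edges T \<longrightarrow> att i j \<in> verts (Gs i)) \<and>
     verts G = (\<Union>i \<in> verts T. verts (Gs i)) \<and>
     edges G = (\<Union>i \<in> verts T. edges (Gs i)) \<union> chain_bridges T att"

definition part_of :: "'i ugraph \<Rightarrow> ('i \<Rightarrow> 'a ugraph) \<Rightarrow> 'a \<Rightarrow> 'a ugraph" where
  "part_of T Gs z = Gs (THE j. j \<in> verts T \<and> z \<in> verts (Gs j))"

text \<open>An end of a bridge is a pair \<open>(x, b)\<close> of a bridge \<open>b\<close> and a vertex \<open>x \<in> b\<close>, so that a vertex
  incident to several bridges yields one end for each of them.\<close>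

definition bridge_ends :: "'a set set \<Rightarrow> 'a ugraph \<Rightarrow> ('a \<times> 'a set) set" where
  "bridge_ends B H = {(x, b). b \<in> B \<and> x \<in> b \<and> x \<in> verts H}"

definition W :: "'a ugraph \<Rightarrow> 'a \<times> 'a set \<Rightarrow> nat" where
  "W G = (\<lambda>(x, b). num_edges (component_of (delete_edge G b) x))"

definition Wbar :: "'a ugraph \<Rightarrow> 'a \<times> 'a set \<Rightarrow> real" where
  "Wbar G z = real (num_edges G) - real (W G z)"

text \<open>\<open>d\<^sup>T R e\<^sub>x\<close> for the degree vector \<open>d\<close> and resistance matrix \<open>R\<close> of \<open>H\<close>.\<close>

definition degree_resistance :: "'a ugraph \<Rightarrow> 'a \<Rightarrow> real" where
  "degree_resistance H x =
     inner_on (verts H) (degree_vec H) (mat_vec_on (verts H) (resistance H) (unit_vec x))"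

end

(* Let d be the degree vector of G. Conditioning on the first step shows that the hitting times h_j
   of j satisfy L h_j = d - 2m e_j, where L is the Laplacian. Hence h_i(j) + h_j(i) = 2m r(i, j)
   and 4m kappa(G) = d^T R d. In a chain, r(u, v) is the sum over the parts G_i of the resistance in
   G_i between the gates through which G_i is entered from u and from v, plus the number of bridges
   separating u from v: this function satisfies the Laplace equation that characterises
   resistances. Pushing d forward along the gate map of G_i gives the degree vector of G_i plus the
   mass 2 Wbar_z at every bridge end z in G_i. Expanding the quadratic form in these measures
   gives the formula. *)
theory Submission
  imports Defs
begin

section \<open>Laplacians of finite graphs\<close>

text \<open>Resistance and Kemeny's constant are defined by \<open>THE\<close> and mean first
  passage times by a series, so existence, uniqueness and convergence must be settled before
  anything can be computed. The Laplacian is treated as an operator, and the analytic input is a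
  maximum principle: on a connected graph, a function harmonic off one vertex is constant. It yields
  almost sure hitting, independence of the starting vertex, and uniqueness of potentials. Hitting
  times also supply the Green functions from which the pseudoinverse is built, so no spectral theory
  is involved. Resistances are recognised by an equation with a free term: the Laplacian of the
  column of v is c - 2 e_v with c independent of v. For a chain this leaves a local check at each
  vertex, in which only the terms depending on v matter. Sums over tree edges run over ordered pairs
  (i, j), which name an edge together with one of its ends; this is where the final factors 1/2 come
  from.\<close>

definition lap :: "'a ugraph \<Rightarrow> ('a \<Rightarrow> real) \<Rightarrow> 'a \<Rightarrow> real" where
  "lap H f u = (\<Sum>w\<in>neighbours H u. f u - f w)"

locale sgraph =
  fixes H :: "'a ugraph"
  assumes simple: "simple_graph H"
begin

lemma finite_verts [simp]: "finite (verts H)"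
  using simple by (simp add: simple_graph_def)

lemma edgeD: "{u, v} \<in> edges H \<Longrightarrow> u \<in> verts H \<and> v \<in> verts H \<and> u \<noteq> v"
  using simple by (fastforce simp: simple_graph_def doubleton_eq_iff)

lemma edgeE:
  assumes "e \<in> edges H"
  obtains u v where "e = {u, v}" "u \<in> verts H" "v \<in> verts H" "u \<noteq> v"
  using simple assms by (auto simp: simple_graph_def)

lemma edge_subset: "e \<in> edges H \<Longrightarrow> e \<subseteq> verts H"
  by (auto elim: edgeE)

lemma finite_edges [simp]: "finite (edges H)"
  by (rule finite_subset[of _ "Pow (verts H)"]) (auto dest: edge_subset)

lemma neighbours_subset: "neighbours H u \<subseteq> verts H"
  by (auto simp: neighbours_def dest: edgeD)

lemma finite_neighbours [simp]: "finite (neighbours H u)"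
  using neighbours_subset finite_subset finite_verts by blast

lemma neighbours_sym: "v \<in> neighbours H u \<longleftrightarrow> u \<in> neighbours H v"
  by (simp add: neighbours_def insert_commute)

lemma degree_eq_card_incident: "degree H v = card {e \<in> edges H. v \<in> e}"
  unfolding degree_def
proof (rule bij_betw_same_card[where f = "\<lambda>u. {v, u}"], rule bij_betwI')
  fix e assume "e \<in> {e \<in> edges H. v \<in> e}"
  then have e: "e \<in> edges H" "v \<in> e"
    by auto
  then obtain a b where "e = {a, b}"
    using edgeE by blast
  with e have "e = {v, a} \<or> e = {v, b}"
    by auto
  then show "\<exists>u\<in>neighbours H v. e = {v, u}"
    using e by (auto simp: neighbours_def)
qed (auto simp: neighbours_def doubleton_eq_iff)

lemma handshake: "(\<Sum>v\<in>verts H. degree H v) = 2 * num_edges H"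
proof -
  have "card {v \<in> verts H. v \<in> e} = 2" if "e \<in> edges H" for e
  proof -
    have "{v \<in> verts H. v \<in> e} = e"
      using edge_subset[OF that] by auto
    then show ?thesis
      using that by (auto elim: edgeE)
  qed
  then show ?thesis
    unfolding degree_eq_card_incident num_edges_def
    by (subst sum_multicount[where k = 2]) auto
qed

text \<open>Self-adjointness: the degree part is symmetric in f and g, and the adjacency part is a
  sum over ordered pairs of adjacent vertices, which may be swapped.\<close>

lemma lap_sym: "(\<Sum>u\<in>verts H. g u * lap H f u) = (\<Sum>u\<in>verts H. f u * lap H g u)"
proof -
  have eq: "(\<Sum>u\<in>verts H. a u * lap H b u) =
      (\<Sum>u\<in>verts H. a u * b u * degree H u) -
      (\<Sum>u\<in>verts H. \<Sum>w\<in>verts H. if w \<in> neighbours H u then a u * b w else 0)"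
    for a b :: "'a \<Rightarrow> real"
  proof -
    have "(\<Sum>w\<in>verts H. if w \<in> neighbours H u then a u * b w else 0) =
        (\<Sum>w\<in>neighbours H u. a u * b w)" for u
      using neighbours_subset[of u]
      by (simp add: sum.If_cases Int_absorb1)
    then show ?thesis
      by (simp add: lap_def sum_distrib_left sum_subtractf right_diff_distrib degree_def
          mult_ac)
  qed
  show ?thesis
    unfolding eq by (subst (2) sum.swap) (simp add: mult.commute neighbours_sym cong: if_cong)
qed

lemma sum_lap: "(\<Sum>u\<in>verts H. lap H f u) = 0"
  using lap_sym[of "\<lambda>_. 1" f] by (simp add: lap_def)

text \<open>Link between the matrix that defines resistance and the operator used in the arguments:
  row u is supported on u and its neighbours, and u is not its own neighbour.\<close>

lemma laplacian_mult:
  assumes "u \<in> verts H"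
  shows "(\<Sum>w\<in>verts H. laplacian H u w * f w) = lap H f u"
proof -
  have u: "u \<notin> neighbours H u"
    using edgeD[of u u] by (auto simp: neighbours_def)
  have "(\<Sum>w\<in>verts H. laplacian H u w * f w) =
      laplacian H u u * f u + (\<Sum>w\<in>verts H - {u}. laplacian H u w * f w)"
    using assms by (simp add: sum.remove)
  also have "(\<Sum>w\<in>verts H - {u}. laplacian H u w * f w) =
      (\<Sum>w\<in>neighbours H u. laplacian H u w * f w)"
    using neighbours_subset[of u] u
    by (intro sum.mono_neutral_right) (auto simp: laplacian_def neighbours_def)
  also have "\<dots> = (\<Sum>w\<in>neighbours H u. - f w)"
    using u by (intro sum.cong) (auto simp: laplacian_def neighbours_def)
  finally show ?thesis
    by (simp add: lap_def laplacian_def degree_def sum_subtractf sum_negf)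
qed

lemma laplacian_sym: "laplacian H u w = laplacian H w u"
  by (simp add: laplacian_def insert_commute)

end

lemma lap_diff: "lap H (\<lambda>x. f x - g x) u = lap H f u - lap H g u"
  by (simp add: lap_def flip: sum_subtractf) (simp add: algebra_simps)

lemma lap_add: "lap H (\<lambda>x. f x + g x) u = lap H f u + lap H g u"
  by (simp add: lap_def flip: sum.distrib) (simp add: algebra_simps)

lemma lap_cmult: "lap H (\<lambda>x. c * f x) u = c * lap H f u"
  by (simp add: lap_def sum_distrib_left algebra_simps)

lemma lap_sum: "lap H (\<lambda>x. \<Sum>i\<in>I. f i x) u = (\<Sum>i\<in>I. lap H (f i) u)"
  unfolding lap_def by (subst sum.swap) (simp add: sum_subtractf)

lemma lap_const: "lap H (\<lambda>x. c) u = 0"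
  by (simp add: lap_def)

section \<open>Maximum principle on connected graphs\<close>

locale conn_graph =
  fixes H :: "'a ugraph"
  assumes conn: "connected_graph H"

sublocale conn_graph \<subseteq> sgraph H
  by unfold_locales (use conn in \<open>simp add: connected_graph_def\<close>)

context conn_graph
begin

lemma verts_nonempty: "verts H \<noteq> {}"
  using conn by (simp add: connected_graph_def)

lemma reachable: "u \<in> verts H \<Longrightarrow> v \<in> verts H \<Longrightarrow> reachable H u v"
  using conn by (simp add: connected_graph_def)

text \<open>At a maximiser other than j all differences to neighbours are nonnegative while their
  sum is at most 0, so each vanishes. The maximum thus spreads along a walk until it reaches
  j.\<close>

lemma maximum_principle:
  assumes j: "j \<in> verts H" and u: "u \<in> verts H"
    and sub: "\<And>u. u \<in> verts H \<Longrightarrow> u \<noteq> j \<Longrightarrow> lap H f u \<le> 0"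
  shows "f u \<le> f j"
proof -
  define M where "M = Max (f ` verts H)"
  have M_ge: "f x \<le> M" if "x \<in> verts H" for x
    using that by (simp add: M_def)
  have "M \<in> f ` verts H"
    unfolding M_def using u by (intro Max_in) auto
  then obtain a where a: "a \<in> verts H" "f a = M"
    by auto
  \<comment> \<open>The first alternative covers walks that pass through j, where nothing is known
    about the Laplacian.\<close>
  have "f j = M \<or> b \<in> verts H \<and> f b = M" if "(a, b) \<in> {(a, b). {a, b} \<in> edges H}\<^sup>*" for b
    using that
  proof induction
    case base
    then show ?case using a by simp
  next
    case (step b c)
    show ?case
    proof (cases "f j = M")
      case False
      with step have b: "b \<in> verts H" "f b = M" "b \<noteq> j" and c: "c \<in> neighbours H b"
        by (auto simp: neighbours_def)
      have nonneg: "0 \<le> f b - f w" if "w \<in> neighbours H b" for w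
        using M_ge[of w] neighbours_subset b that by auto
      have "lap H f b = 0"
        using sub[OF b(1,3)] sum_nonneg[of "neighbours H b" "\<lambda>w. f b - f w", OF nonneg] by (simp add: lap_def)
      then have "f b - f c = 0"
        using sum_nonneg_0[of "neighbours H b" "\<lambda>w. f b - f w" c] nonneg c by (simp add: lap_def)
      then show ?thesis
        using b c neighbours_subset by auto
    qed auto
  qed
  then have "f j = M"
    using reachable[OF a(1) j] unfolding reachable_def by blast
  then show ?thesis
    using M_ge u by simp
qed

text \<open>Maximum principle for f and for -f. In this form it serves as the uniqueness theorem for
  potentials.\<close>

lemma harmonic_const:
  assumes "\<And>u. u \<in> verts H \<Longrightarrow> u \<noteq> j \<Longrightarrow> lap H f u = 0" "j \<in> verts H" "u \<in> verts H"
  shows "f u = f j"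
proof (rule antisym)
  show "f u \<le> f j"
    using assms by (intro maximum_principle) auto
  have "- f u \<le> - f j"
    using assms lap_cmult[of H "-1" f] by (intro maximum_principle[of j u "\<lambda>x. - f x"]) auto
  then show "f j \<le> f u"
    by simp
qed

lemma neighbours_nonempty:
  assumes "edges H \<noteq> {}" "u \<in> verts H"
  shows "neighbours H u \<noteq> {}"
proof -
  obtain a b where ab: "{a, b} \<in> edges H" "a \<in> verts H" "b \<in> verts H" "a \<noteq> b"
    using assms(1) edgeE by (metis all_not_in_conv)
  then obtain c where "c \<in> verts H" "c \<noteq> u"
    by metis
  then have "(u, c) \<in> {(a, b). {a, b} \<in> edges H}\<^sup>*" "u \<noteq> c"
    using reachable assms(2) by (auto simp: reachable_def)
  then show ?thesis
    by (cases rule: converse_rtranclE) (auto simp: neighbours_def)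
qed

end

section \<open>Hitting times of the random walk\<close>

lemma measure_bind_pmf_of_set:
  assumes "finite S" "S \<noteq> {}"
  shows "measure_pmf.prob (bind_pmf (pmf_of_set S) f) A =
      (\<Sum>x\<in>S. measure_pmf.prob (f x) A) / real (card S)"
proof -
  \<comment> \<open>Read as the mass at \<open>True\<close> of an image on \<open>bool\<close>, the
    probability of an event is a value of \<open>pmf\<close>, to which the rule for
    \<open>bind_pmf\<close> applies.\<close>
  have prob: "measure_pmf.prob p A = pmf (map_pmf (\<lambda>x. x \<in> A) p) True" for p :: "'b pmf"
    by (simp add: pmf_map vimage_def)
  show ?thesis
    unfolding prob map_bind_pmf pmf_bind using assms by (simp add: integral_pmf_of_set)
qed

text \<open>The probability that the walk started at \<open>u\<close> visits \<open>j\<close> for the first time at time \<open>n\<close>,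
  where, unlike for the first passage, the position at time \<open>0\<close> counts as a visit.\<close>

primrec hit :: "'a ugraph \<Rightarrow> 'a \<Rightarrow> nat \<Rightarrow> 'a \<Rightarrow> real" where
  "hit H j 0 u = (if u = j then 1 else 0)"
| "hit H j (Suc n) u =
    (if u = j then 0 else (\<Sum>w\<in>neighbours H u. hit H j n w) / real (degree H u))"

definition hitting_time :: "'a ugraph \<Rightarrow> 'a \<Rightarrow> 'a \<Rightarrow> real" where
  "hitting_time H j u = (\<Sum>n. real n * hit H j n u)"

text \<open>The probability that the hitting time of j exceeds n, written as a complement; that it
  is nonnegative has to be derived from the first-step recursion.\<close>

definition tail_prob :: "'a ugraph \<Rightarrow> 'a \<Rightarrow> nat \<Rightarrow> 'a \<Rightarrow> real" where
  "tail_prob H j n u = 1 - (\<Sum>k\<le>n. hit H j k u)"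

lemma walk_pmf_start: "p \<in> set_pmf (walk_pmf H n i) \<Longrightarrow> p ! 0 = i"
  by (cases n) auto

lemma hit_nonneg: "hit H j n u \<ge> 0"
  by (induction n arbitrary: u) (auto intro!: divide_nonneg_nonneg sum_nonneg)

lemma hit_target: "hit H j n j = (if n = 0 then 1 else 0)"
  by (cases n) auto

lemma tail_prob_target: "tail_prob H j n j = 0"
  by (simp add: tail_prob_def hit_target sum.delta)

lemma tail_prob_le_1: "tail_prob H j n u \<le> 1"
  by (simp add: tail_prob_def hit_nonneg sum_nonneg)

lemma decseq_tail_prob: "decseq (\<lambda>n. tail_prob H j n u)"
  by (rule decseq_SucI) (simp add: tail_prob_def hit_nonneg del: hit.simps)

lemma hit_Suc_tail: "hit H j (Suc n) u = tail_prob H j n u - tail_prob H j (Suc n) u"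
  by (simp add: tail_prob_def del: hit.simps)

locale walk_graph = conn_graph +
  assumes edges_nonempty: "edges H \<noteq> {}"
begin

lemma degree_pos: "u \<in> verts H \<Longrightarrow> degree H u > 0"
  using neighbours_nonempty[OF edges_nonempty] by (simp add: degree_def card_gt_0_iff)

text \<open>First-step analysis. The two conventions on time 0 agree when the start differs from j;
  they part company once the walk has stepped onto j, which is why that neighbour is a separate
  case.\<close>

lemma first_passage_eq_hit:
  assumes "i \<in> verts H" "i \<noteq> j"
  shows "first_passage_prob H i j n = hit H j n i"
  using assms
proof (induction n arbitrary: i)
  case 0
  then show ?case
    by (simp add: first_passage_prob_def)
next
  case (Suc n)
  \<comment> \<open>The event for the walk after its first step. The shifted index ranges over
    positions 0 to n - 1, so here a start in j does count as a visit.\<close>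
  define E where "E = {p. p ! n = j \<and> (\<forall>t. 1 \<le> t \<and> t < Suc n \<longrightarrow> p ! (t - 1) \<noteq> j)}"
  have step: "measure_pmf.prob (walk_pmf H n u) E = hit H j n u" if u: "u \<in> neighbours H i" for u
  proof (cases "u = j")
    case True
    have "measure_pmf.prob (walk_pmf H n u) E = (if n = 0 then 1 else 0)"
    proof (cases n)
      case 0
      then show ?thesis
        using True by (simp add: E_def)
    next
      case (Suc m)
      have "AE p in walk_pmf H n u. p \<notin> E"
        unfolding AE_measure_pmf_iff E_def using Suc True
        by (auto dest!: walk_pmf_start intro!: exI[of _ 1])
      then show ?thesis
        using Suc measure_pmf.prob_eq_0[of E "walk_pmf H n u"] by simp
    qed
    then show ?thesis
      using True by (simp add: hit_target)
  next
    case False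
    have "p \<in> E \<longleftrightarrow> p ! n = j \<and> (\<forall>t. 1 \<le> t \<and> t < n \<longrightarrow> p ! t \<noteq> j)"
      if "p \<in> set_pmf (walk_pmf H n u)" for p
    proof -
      have "(\<forall>t. 1 \<le> t \<and> t < Suc n \<longrightarrow> p ! (t - 1) \<noteq> j) \<longleftrightarrow> (\<forall>t<n. p ! t \<noteq> j)"
        by (metis Suc_le_eq Suc_less_eq diff_Suc_1 gr0_implies_Suc le_numeral_extra(4) not_less_eq
            One_nat_def less_Suc_eq_le zero_less_Suc)
      also have "\<dots> \<longleftrightarrow> (\<forall>t. 1 \<le> t \<and> t < n \<longrightarrow> p ! t \<noteq> j)"
        using walk_pmf_start[OF that] False by (metis Suc_le_eq One_nat_def neq0_conv)
      finally show ?thesis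
        by (simp add: E_def)
    qed
    then have "measure_pmf.prob (walk_pmf H n u) E = first_passage_prob H u j n"
      unfolding first_passage_prob_def
      by (intro measure_pmf.finite_measure_eq_AE) (auto simp: AE_measure_pmf_iff)
    then show ?thesis
      using Suc.IH[of u] False u neighbours_subset by auto
  qed
  have "first_passage_prob H i j (Suc n) =
      (\<Sum>u\<in>neighbours H i. measure_pmf.prob (walk_pmf H n u) E) / real (degree H i)"
    using Suc.prems neighbours_nonempty[OF edges_nonempty]
    unfolding first_passage_prob_def walk_pmf.simps
    by (subst measure_bind_pmf_of_set) (auto simp: E_def vimage_def degree_def nth_Cons')
  then show ?case
    using Suc.prems step by simp
qed

text \<open>The constant 1 is its own average over the neighbours, so the recursion of
  \<open>hit\<close> passes to the tails; the term at time 0 vanishes since u differs from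
  j.\<close>

lemma tail_prob_Suc:
  assumes "u \<in> verts H" "u \<noteq> j"
  shows "tail_prob H j (Suc n) u = (\<Sum>w\<in>neighbours H u. tail_prob H j n w) / real (degree H u)"
proof -
  have "(\<Sum>k\<le>Suc n. hit H j k u) = (\<Sum>k\<le>n. hit H j (Suc k) u)"
    using assms by (subst sum.atMost_Suc_shift) simp
  also have "\<dots> = (\<Sum>w\<in>neighbours H u. \<Sum>k\<le>n. hit H j k w) / real (degree H u)"
    using assms by (subst sum.swap) (simp add: sum_divide_distrib)
  finally show ?thesis
    using degree_pos[OF assms(1)] neighbours_nonempty[OF edges_nonempty assms(1)]
    unfolding tail_prob_def
    by (simp add: sum_subtractf diff_divide_distrib degree_def del: sum.atMost_Suc hit.simps)
qed

lemma tail_prob_nonneg: "u \<in> verts H \<Longrightarrow> tail_prob H j n u \<ge> 0"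
proof (induction n arbitrary: u)
  case 0
  then show ?case
    by (simp add: tail_prob_def)
next
  case (Suc n)
  then show ?case
    using neighbours_subset
    by (cases "u = j") (auto simp: tail_prob_target tail_prob_Suc intro!: divide_nonneg_nonneg sum_nonneg)
qed

text \<open>The limit of the tails is harmonic off \<open>j\<close> and vanishes at \<open>j\<close>.\<close>

lemma tail_prob_tendsto_0:
  assumes j: "j \<in> verts H" and u: "u \<in> verts H"
  shows "(\<lambda>n. tail_prob H j n u) \<longlonglongrightarrow> 0"
proof -
  define l where "l u = lim (\<lambda>n. tail_prob H j n u)" for u
  have l: "(\<lambda>n. tail_prob H j n u) \<longlonglongrightarrow> l u" if "u \<in> verts H" for u
  proof -
    have "convergent (\<lambda>n. tail_prob H j n u)"
    proof (rule Bseq_monoseq_convergent[OF BseqI'[of _ 1]])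
      show "norm (tail_prob H j n u) \<le> 1" for n
        using tail_prob_nonneg[OF that, of j n] tail_prob_le_1[of H j n u] by simp
      show "monoseq (\<lambda>n. tail_prob H j n u)"
        by (rule decseq_imp_monoseq[OF decseq_tail_prob])
    qed
    then show ?thesis
      unfolding l_def by (simp add: convergent_LIMSEQ_iff)
  qed
  have "lap H l x = 0" if x: "x \<in> verts H" "x \<noteq> j" for x
  proof -
    have "(\<lambda>n. tail_prob H j (Suc n) x) \<longlonglongrightarrow> l x"
      using l[OF x(1)] by (rule LIMSEQ_Suc)
    moreover have "(\<lambda>n. tail_prob H j (Suc n) x) \<longlonglongrightarrow>
        (\<Sum>w\<in>neighbours H x. l w) / real (degree H x)"
      unfolding tail_prob_Suc[OF x]
      using neighbours_subset l degree_pos[OF x(1)] by (intro tendsto_intros) auto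
    ultimately have "l x = (\<Sum>w\<in>neighbours H x. l w) / real (degree H x)"
      by (rule LIMSEQ_unique)
    then show ?thesis
      using degree_pos[OF x(1)] by (simp add: lap_def sum_subtractf degree_def field_simps)
  qed
  then have "l u = l j"
    using harmonic_const j u by blast
  also have "l j = 0"
    using l[OF j] by (simp add: tail_prob_target LIMSEQ_const_iff)
  finally show ?thesis
    using l[OF u] by simp
qed

text \<open>Finiteness of the graph gives one N at which all tails are below 1/2. The averaging
  recursion carries this to a halving over every N further steps, which is what finite expectation
  requires.\<close>

lemma tail_prob_sum_bounded:
  assumes j: "j \<in> verts H"
  obtains C where "\<And>n u. u \<in> verts H \<Longrightarrow> (\<Sum>k<n. tail_prob H j k u) \<le> C"
proof -
  have "\<forall>\<^sub>F n in sequentially. \<forall>u\<in>verts H. tail_prob H j n u < 1 / 2"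
    using tail_prob_tendsto_0[OF j]
    by (intro eventually_ball_finite ballI order_tendstoD(2)) auto
  then obtain N where N: "\<And>u. u \<in> verts H \<Longrightarrow> tail_prob H j N u < 1 / 2"
    by (auto simp: eventually_sequentially)
  have half: "tail_prob H j (N + n) u \<le> tail_prob H j n u / 2" if "u \<in> verts H" for n u
    using that
  proof (induction n arbitrary: u)
    case 0
    then show ?case
      using N[of u] by (cases "u = j") (auto simp: tail_prob_target tail_prob_def[of _ _ 0])
  next
    case (Suc n)
    show ?case
    proof (cases "u = j")
      case False
      have "(\<Sum>w\<in>neighbours H u. tail_prob H j (N + n) w) \<le>
          (\<Sum>w\<in>neighbours H u. tail_prob H j n w / 2)"
        using Suc.IH neighbours_subset by (intro sum_mono) auto
      then have "(\<Sum>w\<in>neighbours H u. tail_prob H j (N + n) w) / real (degree H u) \<le>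
          (\<Sum>w\<in>neighbours H u. tail_prob H j n w) / 2 / real (degree H u)"
        by (intro divide_right_mono) (simp_all add: sum_divide_distrib)
      then show ?thesis
        using False Suc.prems by (simp add: tail_prob_Suc)
    qed (simp add: tail_prob_target)
  qed
  \<comment> \<open>Splitting off the first N terms, each at most 1, gives S \<le> N + S / 2 for the
    partial sum S.\<close>
  have "(\<Sum>k<n. tail_prob H j k u) \<le> 2 * real N" if u: "u \<in> verts H" for n u
  proof -
    have "(\<Sum>k<n. tail_prob H j k u) \<le> (\<Sum>k<N + n. tail_prob H j k u)"
      using tail_prob_nonneg[OF u] by (intro sum_mono2) auto
    also have "\<dots> = (\<Sum>k<N. tail_prob H j k u) + (\<Sum>k<n. tail_prob H j (N + k) u)"
      by (induction n) auto
    also have "\<dots> \<le> real N + (\<Sum>k<n. tail_prob H j k u / 2)"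
      using half[OF u] sum_bounded_above[of "{..<N}", OF tail_prob_le_1]
      by (intro add_mono sum_mono) auto
    finally show ?thesis
      by (simp flip: sum_divide_distrib)
  qed
  then show ?thesis
    using that by blast
qed

lemma hit_sums_1:
  assumes "j \<in> verts H" "u \<in> verts H"
  shows "(\<lambda>n. hit H j n u) sums 1"
proof -
  have "(\<lambda>n. 1 - tail_prob H j n u) \<longlonglongrightarrow> 1 - 0"
    by (intro tendsto_intros tail_prob_tendsto_0 assms)
  then show ?thesis
    by (simp add: sums_def_le tail_prob_def)
qed

lemma summable_hitting_time:
  assumes j: "j \<in> verts H" and u: "u \<in> verts H"
  shows "summable (\<lambda>n. real n * hit H j n u)"
proof -
  obtain C where C: "\<And>n u. u \<in> verts H \<Longrightarrow> (\<Sum>k<n. tail_prob H j k u) \<le> C"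
    using tail_prob_sum_bounded[OF j] by blast
  \<comment> \<open>Summation by parts. The boundary term is subtracted and nonnegative, so dropping
    it keeps the upper bound.\<close>
  have "(\<Sum>k\<le>n. real k * hit H j k u) =
      (\<Sum>k<n. tail_prob H j k u) - real n * tail_prob H j n u" for n
    by (induction n) (simp_all add: hit_Suc_tail algebra_simps del: hit.simps)
  then have "(\<Sum>k\<le>n. real k * hit H j k u) \<le> C" for n
    using C[OF u, of n] tail_prob_nonneg[OF u, of j n] by (smt (verit) mult_nonneg_nonneg of_nat_0_le_iff)
  then show ?thesis
    by (intro bounded_imp_summable[of _ C]) (simp_all add: hit_nonneg)
qed

lemma hitting_time_target: "hitting_time H j j = 0"
proof -
  have "(\<lambda>n. real n * hit H j n j) = (\<lambda>n. 0)"
    by (auto simp: hit_target)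
  then show ?thesis
    by (simp add: hitting_time_def)
qed

lemma mean_first_passage_eq:
  "i \<in> verts H \<Longrightarrow> i \<noteq> j \<Longrightarrow> mean_first_passage H i j = hitting_time H j i"
  by (simp add: mean_first_passage_def hitting_time_def first_passage_eq_hit)

text \<open>Conditioning on the first step turns n into n + 1; the surplus series of hitting
  probabilities sums to 1 at each neighbour, and these ones add up to the degree.\<close>

lemma lap_hitting_time_off:
  assumes j: "j \<in> verts H" and u: "u \<in> verts H" "u \<noteq> j"
  shows "lap H (hitting_time H j) u = degree H u"
proof -
  have w: "w \<in> verts H" if "w \<in> neighbours H u" for w
    using that neighbours_subset by auto
  have Suc: "real (Suc n) * hit H j (Suc n) u =
      (\<Sum>w\<in>neighbours H u. real n * hit H j n w + hit H j n w) / real (degree H u)" for n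
    using u by (simp add: sum_distrib_left distrib_right add.commute)
  have "(\<lambda>n. real n * hit H j n w + hit H j n w) sums (hitting_time H j w + 1)"
    if "w \<in> neighbours H u" for w
    unfolding hitting_time_def
    using summable_hitting_time[OF j w[OF that]] hit_sums_1[OF j w[OF that]]
    by (intro sums_add summable_sums)
  then have "(\<lambda>n. real (Suc n) * hit H j (Suc n) u) sums
      ((\<Sum>w\<in>neighbours H u. hitting_time H j w + 1) / real (degree H u))"
    unfolding Suc by (intro sums_divide sums_sum)
  \<comment> \<open>The term at n = 0 is zero, so the index shift leaves the value
    unchanged.\<close>
  then have "(\<lambda>n. real n * hit H j n u) sums
      ((\<Sum>w\<in>neighbours H u. hitting_time H j w + 1) / real (degree H u))"
    by (subst (asm) sums_Suc_iff) simp
  then have "hitting_time H j u =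
      (\<Sum>w\<in>neighbours H u. hitting_time H j w + 1) / real (degree H u)"
    by (simp add: hitting_time_def sums_iff)
  then have "hitting_time H j u * real (degree H u) = (\<Sum>w\<in>neighbours H u. hitting_time H j w + 1)"
    using degree_pos[OF u(1)] by simp
  then show ?thesis
    by (simp add: lap_def sum_subtractf sum.distrib degree_def mult.commute)
qed

text \<open>The value at the target follows since the Laplacian of any function sums to zero.\<close>

lemma lap_hitting_time:
  assumes j: "j \<in> verts H" and u: "u \<in> verts H"
  shows "lap H (hitting_time H j) u = degree H u - 2 * num_edges H * unit_vec j u"
proof (cases "u = j")
  case True
  have "0 = lap H (hitting_time H j) j + (\<Sum>u\<in>verts H - {j}. lap H (hitting_time H j) u)"
    using sum_lap[of "hitting_time H j"] j by (simp add: sum.remove)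
  also have "(\<Sum>u\<in>verts H - {j}. lap H (hitting_time H j) u) =
      (\<Sum>u\<in>verts H - {j}. real (degree H u))"
    using j by (intro sum.cong) (auto simp: lap_hitting_time_off)
  also have "\<dots> = real (\<Sum>u\<in>verts H. degree H u) - real (degree H j)"
    using j by (simp add: sum.remove)
  finally show ?thesis
    using True by (simp add: handshake unit_vec_def)
qed (use lap_hitting_time_off[OF j u] in \<open>simp add: unit_vec_def\<close>)

end

section \<open>Effective resistance and Kemeny's constant\<close>

lemma mat_mult_on_assoc:
  "mat_mult_on V (mat_mult_on V A B) C = mat_mult_on V A (mat_mult_on V B C)"
proof (intro ext)
  fix u v
  have "mat_mult_on V (mat_mult_on V A B) C u v = (\<Sum>w\<in>V. \<Sum>x\<in>V. A u x * B x w * C w v)"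
    by (simp add: mat_mult_on_def sum_distrib_right)
  also have "\<dots> = mat_mult_on V A (mat_mult_on V B C) u v"
    by (subst sum.swap) (simp add: mat_mult_on_def sum_distrib_left mult.assoc)
  finally show "mat_mult_on V (mat_mult_on V A B) C u v =
      mat_mult_on V A (mat_mult_on V B C) u v" .
qed

lemma mat_mult_on_cong:
  assumes "\<And>w. w \<in> V \<Longrightarrow> A u w = A' u w" "\<And>w. w \<in> V \<Longrightarrow> B w v = B' w v"
  shows "mat_mult_on V A B u v = mat_mult_on V A' B' u v"
  using assms by (simp add: mat_mult_on_def)

text \<open>AX is the orthogonal projection onto the range of A. Concretely AX = (AYA)X = (AY)(AX);
  as both factors are symmetric, transposing gives (AX)(AY) = (AXA)Y = AY.\<close>

lemma symmetric_right_inverse_unique: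
  fixes V :: "'a set"
  defines "mm \<equiv> mat_mult_on V"
  assumes "\<And>u v. u \<in> V \<Longrightarrow> v \<in> V \<Longrightarrow> mm (mm A X) A u v = A u v"
    and "\<And>u v. u \<in> V \<Longrightarrow> v \<in> V \<Longrightarrow> mm (mm A Y) A u v = A u v"
    and X: "\<And>u v. u \<in> V \<Longrightarrow> v \<in> V \<Longrightarrow> mm A X u v = mm A X v u"
    and Y: "\<And>u v. u \<in> V \<Longrightarrow> v \<in> V \<Longrightarrow> mm A Y u v = mm A Y v u"
    and u: "u \<in> V" and v: "v \<in> V"
  shows "mm A X u v = mm A Y u v"
proof -
  have "mm A X u v = mm (mm (mm A Y) A) X u v"
    unfolding mm_def using assms by (intro mat_mult_on_cong) (auto simp: mm_def)
  also have "\<dots> = mm (mm A Y) (mm A X) u v"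
    by (simp add: mm_def mat_mult_on_assoc)
  also have "\<dots> = mm (mm A X) (mm A Y) v u"
    using X Y u v unfolding mm_def mat_mult_on_def[of V "mat_mult_on V A X"]
      mat_mult_on_def[of V "mat_mult_on V A Y"]
    by (intro sum.cong) (auto simp: mult.commute)
  also have "\<dots> = mm (mm (mm A X) A) Y v u"
    by (simp add: mm_def mat_mult_on_assoc)
  also have "\<dots> = mm A Y v u"
    unfolding mm_def using assms by (intro mat_mult_on_cong) (auto simp: mm_def)
  finally show ?thesis
    using Y u v by simp
qed

text \<open>Transposition exchanges left and right products and reduces this to the preceding
  case.\<close>

lemma symmetric_left_inverse_unique:
  fixes V :: "'a set"
  defines "mm \<equiv> mat_mult_on V"
  assumes "\<And>u v. u \<in> V \<Longrightarrow> v \<in> V \<Longrightarrow> mm (mm A X) A u v = A u v"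
    and "\<And>u v. u \<in> V \<Longrightarrow> v \<in> V \<Longrightarrow> mm (mm A Y) A u v = A u v"
    and "\<And>u v. u \<in> V \<Longrightarrow> v \<in> V \<Longrightarrow> mm X A u v = mm X A v u"
    and "\<And>u v. u \<in> V \<Longrightarrow> v \<in> V \<Longrightarrow> mm Y A u v = mm Y A v u"
    and "u \<in> V" and "v \<in> V"
  shows "mm X A u v = mm Y A u v"
proof -
  define tr where "tr M = (\<lambda>u v. M v u)" for M :: "'a \<Rightarrow> 'a \<Rightarrow> real"
  have tr_mm: "mat_mult_on V (tr M) (tr N) = tr (mat_mult_on V N M)" for M N
    by (simp add: tr_def mat_mult_on_def mult.commute)
  have "mat_mult_on V (tr A) (tr X) v u = mat_mult_on V (tr A) (tr Y) v u"
    using assms by (intro symmetric_right_inverse_unique)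
      (simp_all add: tr_mm mat_mult_on_assoc, simp_all add: tr_def)
  then show ?thesis
    unfolding tr_mm by (simp add: tr_def mm_def)
qed

text \<open>The chain X = XAX = XAY = YAY = Y on V; elsewhere both functions are normalised to 0.
  Uniqueness is what allows the \<open>THE\<close> in \<open>MP_inverse_on\<close> to be
  evaluated.\<close>

lemma MP_inverse_unique:
  assumes X: "is_MP_inverse_on V A X" and Y: "is_MP_inverse_on V A Y"
  shows "X = Y"
proof (intro ext)
  fix u v
  show "X u v = Y u v"
  proof (cases "u \<in> V \<and> v \<in> V")
    case True
    have AX: "mat_mult_on V A X u v = mat_mult_on V A Y u v" if "u \<in> V" "v \<in> V" for u v
      using X Y that by (intro symmetric_right_inverse_unique) (auto simp: is_MP_inverse_on_def)
    have XA: "mat_mult_on V X A u v = mat_mult_on V Y A u v" if "u \<in> V" "v \<in> V" for u v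
      using X Y that by (intro symmetric_left_inverse_unique) (auto simp: is_MP_inverse_on_def)
    have "X u v = mat_mult_on V X (mat_mult_on V A X) u v"
      using X True by (simp add: is_MP_inverse_on_def mat_mult_on_assoc)
    also have "\<dots> = mat_mult_on V X (mat_mult_on V A Y) u v"
      by (rule mat_mult_on_cong) (use AX True in auto)
    also have "\<dots> = mat_mult_on V (mat_mult_on V X A) Y u v"
      by (simp add: mat_mult_on_assoc)
    also have "\<dots> = mat_mult_on V (mat_mult_on V Y A) Y u v"
      by (rule mat_mult_on_cong) (use XA True in auto)
    also have "\<dots> = Y u v"
      using Y True by (simp add: is_MP_inverse_on_def)
    finally show ?thesis .
  next
    case False
    then show ?thesis
      using X Y by (auto simp: is_MP_inverse_on_def)
  qed
qed

lemma sum_unit_vec: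
  assumes "finite V" "v \<in> V"
  shows "(\<Sum>w\<in>V. g w * unit_vec v w) = g v" "(\<Sum>w\<in>V. unit_vec v w * g w) = g v"
  using assms by (simp_all add: unit_vec_def if_distrib if_distribR cong: if_cong)

lemma unit_vec_sym: "unit_vec u v = unit_vec v u"
  by (simp add: unit_vec_def)

context sgraph
begin

lemma lap_cong:
  assumes "\<And>w. w \<in> verts H \<Longrightarrow> f w = g w" "u \<in> verts H"
  shows "lap H f u = lap H g u"
  unfolding lap_def using assms neighbours_subset by (intro sum.cong) auto

end

section \<open>Green functions, the pseudoinverse of the Laplacian and resistances\<close>

context conn_graph
begin

lemma singleton_if_no_edges:
  assumes "edges H = {}" "v \<in> verts H"
  shows "verts H = {v}"
proof -
  have "u = v" if "u \<in> verts H" for u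
    using reachable[OF assms(2) that] assms(1) by (simp add: reachable_def)
  then show ?thesis
    using assms(2) by blast
qed

lemma card_verts_pos: "card (verts H) > 0"
  using verts_nonempty by (simp add: card_gt_0_iff)

text \<open>Up to scaling, the Green function with pole \<open>v\<close> is the average over \<open>w\<close> of the
  differences of the hitting times of \<open>w\<close> and of \<open>v\<close>.\<close>

lemma ex_green_function:
  assumes v: "v \<in> verts H"
  shows "\<exists>f. \<forall>u\<in>verts H. lap H f u = unit_vec v u - 1 / real (card (verts H))"
proof (cases "edges H = {}")
  case True
  then show ?thesis
    using singleton_if_no_edges[OF True v]
    by (simp add: lap_def neighbours_def unit_vec_def)
next
  case False
  interpret walk_graph H
    by unfold_locales (rule False)
  define m where "m = real (num_edges H)"
  define n where "n = real (card (verts H))"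
  have m: "m \<noteq> 0" and n: "n \<noteq> 0"
    using False card_verts_pos by (auto simp: m_def n_def num_edges_def)
  \<comment> \<open>The difference of the hitting times of w and v has Laplacian 2m (e_v - e_w).
    Summing over the n vertices w gives 2m (n e_v - 1), hence the prefactor.\<close>
  define f where
    "f x = 1 / (2 * m * n) * (\<Sum>w\<in>verts H. hitting_time H w x - hitting_time H v x)" for x
  have "lap H f u = unit_vec v u - 1 / n" if u: "u \<in> verts H" for u
  proof -
    have "lap H f u = 1 / (2 * m * n) *
        (\<Sum>w\<in>verts H. 2 * m * (unit_vec v u - unit_vec w u))"
      unfolding f_def lap_cmult lap_sum lap_diff
      using u v by (simp add: lap_hitting_time algebra_simps flip: m_def)
    also have "\<dots> = 1 / n * (\<Sum>w\<in>verts H. unit_vec v u - unit_vec u w)"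
      using m unfolding sum_distrib_left[symmetric] by (simp add: unit_vec_sym[of u])
    also have "\<dots> = 1 / n * (n * unit_vec v u - 1)"
      using u sum_unit_vec(1)[of "verts H" u "\<lambda>_. 1"] by (simp add: sum_subtractf n_def)
    finally show ?thesis
      using n by (simp add: field_simps)
  qed
  then show ?thesis
    unfolding n_def by blast
qed

text \<open>For Y built from Green functions, LY and YL are both the projection onto the vectors of
  sum zero. Columns of L and of Y have sum zero, so they are fixed by it and the Penrose conditions
  follow. Symmetry of Y comes from pairing two of its columns by \<open>lap_sym\<close>.\<close>

lemma laplacian_MP_inverse:
  defines "X \<equiv> MP_inverse_on (verts H) (laplacian H)"
  shows "\<And>u v. u \<in> verts H \<Longrightarrow> v \<in> verts H \<Longrightarrow>
      lap H (\<lambda>w. X w v) u = unit_vec v u - 1 / real (card (verts H))"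
    and "\<And>u v. X u v = X v u"
proof -
  let ?V = "verts H" and ?n = "real (card (verts H))"
  obtain g where g: "\<And>u v. u \<in> ?V \<Longrightarrow> v \<in> ?V \<Longrightarrow> lap H (g v) u = unit_vec v u - 1 / ?n"
    using ex_green_function by metis
  \<comment> \<open>Green functions are determined up to a constant; subtracting the mean makes
    every column sum to zero, which both symmetry and YLY = Y rely on.\<close>
  define Y where
    "Y u v = (if u \<in> ?V \<and> v \<in> ?V then g v u - (\<Sum>w\<in>?V. g v w) / ?n else 0)" for u v
  have lapY: "lap H (\<lambda>w. Y w v) u = unit_vec v u - 1 / ?n" if "u \<in> ?V" "v \<in> ?V" for u v
  proof -
    have "lap H (\<lambda>w. Y w v) u = lap H (\<lambda>w. g v w - (\<Sum>w\<in>?V. g v w) / ?n) u"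
      using that by (intro lap_cong) (auto simp: Y_def)
    then show ?thesis
      using g that by (simp add: lap_diff lap_const)
  qed
  have sumY: "(\<Sum>w\<in>?V. Y w v) = 0" if "v \<in> ?V" for v
    using that card_verts_pos by (simp add: Y_def sum_subtractf)
  have symY: "Y a b = Y b a" for a b
  proof (cases "a \<in> ?V \<and> b \<in> ?V")
    case True
    have "(\<Sum>u\<in>?V. Y u a * lap H (\<lambda>w. Y w b) u) = Y b a" if "a \<in> ?V" "b \<in> ?V" for a b
      using that by (simp add: lapY right_diff_distrib sum_subtractf sum_unit_vec sumY
          flip: sum_divide_distrib)
    from this[of a b] this[of b a] show ?thesis
      using True lap_sym[of "\<lambda>w. Y w a" "\<lambda>w. Y w b"] by simp
  qed (auto simp: Y_def)
  have LY: "mat_mult_on ?V (laplacian H) Y u v = unit_vec v u - 1 / ?n"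
    if "u \<in> ?V" "v \<in> ?V" for u v
    using that laplacian_mult[of u "\<lambda>w. Y w v"] lapY by (simp add: mat_mult_on_def)
  have YL: "mat_mult_on ?V Y (laplacian H) u v = unit_vec v u - 1 / ?n"
    if "u \<in> ?V" "v \<in> ?V" for u v
  proof -
    have "mat_mult_on ?V Y (laplacian H) u v = mat_mult_on ?V (laplacian H) Y v u"
      unfolding mat_mult_on_def
      by (intro sum.cong refl) (metis laplacian_sym symY mult.commute)
    then show ?thesis
      using LY that by (simp add: unit_vec_sym)
  qed
  have sumL: "(\<Sum>w\<in>?V. laplacian H w v) = 0" if "v \<in> ?V" for v
    using laplacian_mult[OF that, of "\<lambda>_. 1"] by (simp add: laplacian_sym[of v] lap_const)
  have "is_MP_inverse_on ?V (laplacian H) Y"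
    unfolding is_MP_inverse_on_def
  proof (intro conjI ballI allI impI)
    fix u v assume uv: "u \<in> ?V" "v \<in> ?V"
    have proj: "(\<Sum>w\<in>?V. (unit_vec w u - 1 / ?n) * f w) = f u" if "(\<Sum>w\<in>?V. f w) = 0" for f
      using that uv
      by (simp add: left_diff_distrib sum_subtractf unit_vec_sym[of _ u] sum_unit_vec
          flip: sum_divide_distrib)
    show "mat_mult_on ?V (mat_mult_on ?V (laplacian H) Y) (laplacian H) u v = laplacian H u v"
      using proj[OF sumL[OF uv(2)]] uv LY by (simp add: mat_mult_on_def[of _ "mat_mult_on _ _ _"])
    show "mat_mult_on ?V (mat_mult_on ?V Y (laplacian H)) Y u v = Y u v"
      using proj[OF sumY[OF uv(2)]] uv YL by (simp add: mat_mult_on_def[of _ "mat_mult_on _ _ _"])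
  qed (auto simp: LY YL unit_vec_sym Y_def)
  then have "X = Y"
    unfolding X_def MP_inverse_on_def using MP_inverse_unique by (intro the_equality) blast+
  then show "\<And>u v. u \<in> verts H \<Longrightarrow> v \<in> verts H \<Longrightarrow>
      lap H (\<lambda>w. X w v) u = unit_vec v u - 1 / ?n" "\<And>u v. X u v = X v u"
    using lapY symY by auto
qed

lemma resistance_MP_inverse:
  assumes "u \<in> verts H" "v \<in> verts H"
  defines "X \<equiv> MP_inverse_on (verts H) (laplacian H)"
  shows "resistance H u v = (X u u - X u v) - (X v u - X v v)"
proof -
  have *: "(\<Sum>b\<in>verts H. g b * (unit_vec u b - unit_vec v b)) = g u - g v"
    "(\<Sum>b\<in>verts H. (unit_vec u b - unit_vec v b) * g b) = g u - g v" for g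
    using assms by (simp_all add: right_diff_distrib left_diff_distrib sum_subtractf sum_unit_vec)
  show ?thesis
    unfolding resistance_def Let_def inner_on_def mat_vec_on_def * X_def by simp
qed

text \<open>Two potentials of the same unit current differ by a harmonic function, hence by a
  constant, so any of them gives the same voltage drop.\<close>

lemma resistance_eq_potential:
  assumes uv: "u \<in> verts H" "v \<in> verts H"
    and f: "\<And>x. x \<in> verts H \<Longrightarrow> lap H f x = unit_vec u x - unit_vec v x"
  shows "resistance H u v = f u - f v"
proof -
  define X where "X = MP_inverse_on (verts H) (laplacian H)"
  have "lap H (\<lambda>w. X w u - X w v - f w) x = 0" if "x \<in> verts H" for x
    using uv that f laplacian_MP_inverse(1) by (simp add: lap_diff X_def)
  then have "X u u - X u v - f u = X v u - X v v - f v"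
    using uv harmonic_const[of v "\<lambda>w. X w u - X w v - f w" u] by auto
  then show ?thesis
    unfolding resistance_MP_inverse[OF uv] by (simp add: X_def)
qed

lemma resistance_sym:
  assumes "u \<in> verts H" "v \<in> verts H"
  shows "resistance H u v = resistance H v u"
  using assms by (simp add: resistance_MP_inverse)

lemma resistance_self: "resistance H u u = 0"
  by (simp add: resistance_def inner_on_def)

text \<open>Apply the Laplacian in w to X_ww + X_vv - 2 X_wv. The function c collects what does not
  depend on v, including the diagonal of the pseudoinverse, whose values never have to be
  known.\<close>

lemma lap_resistance:
  obtains c where "\<And>u v. u \<in> verts H \<Longrightarrow> v \<in> verts H \<Longrightarrow>
      lap H (\<lambda>w. resistance H w v) u = c u - 2 * unit_vec v u"
proof
  fix u v assume uv: "u \<in> verts H" "v \<in> verts H"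
  define X where "X = MP_inverse_on (verts H) (laplacian H)"
  have "lap H (\<lambda>w. resistance H w v) u = lap H (\<lambda>w. X w w + X v v - 2 * X w v) u"
    using uv laplacian_MP_inverse(2)
    by (intro lap_cong) (auto simp: resistance_MP_inverse X_def)
  then show "lap H (\<lambda>w. resistance H w v) u =
      (lap H (\<lambda>w. X w w) u + 2 / real (card (verts H))) - 2 * unit_vec v u"
    using uv laplacian_MP_inverse(1)[OF uv] 
    by (simp add: lap_diff lap_add lap_cmult lap_const X_def right_diff_distrib)
qed

end

section \<open>Commute times and Kemeny's constant\<close>

context walk_graph
begin

lemma num_edges_pos: "num_edges H > 0"
  using edges_nonempty by (simp add: num_edges_def card_gt_0_iff)

text \<open>In the difference of the two hitting times the degree terms of the Laplacians cancel, so
  after division by 2m it is a potential for the unit current from u to v.\<close>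

lemma commute_time:
  assumes uv: "u \<in> verts H" "v \<in> verts H"
  shows "hitting_time H v u + hitting_time H u v = 2 * num_edges H * resistance H u v"
proof -
  define c where "c = 1 / (2 * real (num_edges H))"
  have c: "c * (2 * real (num_edges H)) = 1"
    using num_edges_pos by (simp add: c_def)
  have "lap H (\<lambda>x. c * (hitting_time H v x - hitting_time H u x)) x = unit_vec u x - unit_vec v x"
    if "x \<in> verts H" for x
  proof -
    have "lap H (\<lambda>x. c * (hitting_time H v x - hitting_time H u x)) x =
        c * (2 * real (num_edges H)) * (unit_vec u x - unit_vec v x)"
      using uv that by (simp add: lap_cmult lap_diff lap_hitting_time algebra_simps)
    then show ?thesis
      unfolding c by simp
  qed
  then have "resistance H u v = c * (hitting_time H v u - hitting_time H u u) -
      c * (hitting_time H v v - hitting_time H u v)"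
    by (rule resistance_eq_potential[OF uv])
  then have "resistance H u v = c * (hitting_time H v u + hitting_time H u v)"
    by (simp add: hitting_time_target algebra_simps)
  then show ?thesis
    using num_edges_pos by (simp add: c_def)
qed

lemma sum_stationary: "(\<Sum>j\<in>verts H. stationary H j) = 1"
  using num_edges_pos handshake
  by (simp add: stationary_def flip: sum_divide_distrib of_nat_sum)

text \<open>The weighted sum is harmonic everywhere: its Laplacian at u is deg(u) - 2m \<pi>(u) = 0.
  It is therefore constant in the start, which makes the \<open>THE\<close> in \<open>kemeny\<close>
  meaningful; the diagonal term j = i is zero.\<close>

lemma kemeny_hitting_time:
  assumes i: "i \<in> verts H"
  shows "kemeny H = (\<Sum>j\<in>verts H. stationary H j * hitting_time H j i)"
proof -
  define K where "K i = (\<Sum>j\<in>verts H. stationary H j * hitting_time H j i)" for i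
  have K: "(\<Sum>j\<in>verts H - {i}. stationary H j * mean_first_passage H i j) = K i"
    if "i \<in> verts H" for i
  proof -
    have "K i = (\<Sum>j\<in>verts H - {i}. stationary H j * hitting_time H j i)"
      using that by (simp add: K_def sum.remove hitting_time_target)
    also have "\<dots> = (\<Sum>j\<in>verts H - {i}. stationary H j * mean_first_passage H i j)"
      using that by (intro sum.cong) (auto simp: mean_first_passage_eq)
    finally show ?thesis ..
  qed
  have "lap H K u = 0" if u: "u \<in> verts H" for u
  proof -
    have "lap H K u = (\<Sum>j\<in>verts H. stationary H j *
        (real (degree H u) - 2 * num_edges H * unit_vec u j))"
      unfolding K_def lap_sum lap_cmult
      using u by (intro sum.cong) (simp_all add: lap_hitting_time unit_vec_sym)
    also have "\<dots> = (\<Sum>j\<in>verts H. stationary H j) * real (degree H u) -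
        2 * num_edges H * (\<Sum>j\<in>verts H. stationary H j * unit_vec u j)"
      by (simp add: right_diff_distrib sum_subtractf sum_distrib_left sum_distrib_right mult_ac)
    also have "\<dots> = real (degree H u) - 2 * num_edges H * stationary H u"
      using u by (simp add: sum_stationary sum_unit_vec)
    also have "\<dots> = 0"
      using num_edges_pos by (simp add: stationary_def)
    finally show ?thesis .
  qed
  then have const: "K u = K i" if "u \<in> verts H" for u
    using harmonic_const[of i K u] i that by auto
  have "kemeny H = K i"
    unfolding kemeny_def
  proof (rule the_equality)
    show "\<forall>u\<in>verts H. (\<Sum>j\<in>verts H - {u}. stationary H j * mean_first_passage H u j) = K i"
      using K const by simp
  qed (use K i in auto)
  then show ?thesis
    by (simp add: K_def)
qed

text \<open>Averaging the start over the stationary distribution produces a double sum of hitting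
  times with weight 1/(4 m^2); symmetrising it turns hitting times into commute times.\<close>

lemma kemeny_eq_resistance:
  "4 * num_edges H * kemeny H =
    (\<Sum>u\<in>verts H. \<Sum>v\<in>verts H. real (degree H u) * real (degree H v) * resistance H u v)"
proof -
  define m where "m = real (num_edges H)"
  define d where "d u = real (degree H u)" for u
  have m: "m \<noteq> 0"
    using num_edges_pos by (simp add: m_def)
  define S where "S = (\<Sum>u\<in>verts H. \<Sum>v\<in>verts H. d u * d v * hitting_time H v u)"
  have "kemeny H = (\<Sum>i\<in>verts H. stationary H i * kemeny H)"
    using sum_stationary by (simp flip: sum_distrib_right)
  also have "\<dots> = (\<Sum>i\<in>verts H. \<Sum>j\<in>verts H. d i * d j * hitting_time H j i / (4 * m\<^sup>2))"
    by (intro sum.cong)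
      (simp_all add: kemeny_hitting_time sum_distrib_left stationary_def d_def m_def
        power2_eq_square field_simps)
  finally have K: "kemeny H = S / (4 * m\<^sup>2)"
    by (simp add: S_def sum_divide_distrib)
  have S': "S = (\<Sum>u\<in>verts H. \<Sum>v\<in>verts H. d u * d v * hitting_time H u v)"
    unfolding S_def by (subst sum.swap) (simp add: mult_ac)
  have "2 * m * (\<Sum>u\<in>verts H. \<Sum>v\<in>verts H. d u * d v * resistance H u v) =
      (\<Sum>u\<in>verts H. \<Sum>v\<in>verts H. d u * d v * (hitting_time H v u + hitting_time H u v))"
    unfolding sum_distrib_left by (intro sum.cong refl) (simp add: commute_time m_def)
  also have "\<dots> = S + S"
    by (subst (2) S') (simp add: S_def distrib_left sum.distrib)
  finally show ?thesis
    using m unfolding K d_def[symmetric]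
    by (simp add: power2_eq_square field_simps flip: m_def)
qed

end

context conn_graph
begin

text \<open>Multiplication by the number of edges extends the identity to a single vertex, where
  both sides are 0. Parts of a chain may be of this kind.\<close>

lemma num_edges_kemeny:
  "num_edges H * kemeny H =
    (\<Sum>u\<in>verts H. \<Sum>v\<in>verts H. real (degree H u) * real (degree H v) * resistance H u v) / 4"
proof (cases "edges H = {}")
  case True
  then show ?thesis
    by (simp add: num_edges_def degree_def neighbours_def)
next
  case False
  interpret walk_graph H
    by unfold_locales (rule False)
  show ?thesis
    using kemeny_eq_resistance by simp
qed

end

section \<open>Trees\<close>

lemma edges_delete_edge [simp]: "edges (delete_edge H b) = edges H - {b}"
  by (simp add: delete_edge_def)

lemma verts_delete_edge [simp]: "verts (delete_edge H b) = verts H"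
  by (simp add: delete_edge_def)

lemma reachable_refl [simp]: "reachable H u u"
  by (simp add: reachable_def)

lemma reachable_trans [trans]: "reachable H u v \<Longrightarrow> reachable H v w \<Longrightarrow> reachable H u w"
  unfolding reachable_def by (rule rtrancl_trans)

lemma reachable_edge: "{u, v} \<in> edges H \<Longrightarrow> reachable H u v"
  unfolding reachable_def by auto

lemma reachable_step: "reachable H u v \<Longrightarrow> {v, w} \<in> edges H \<Longrightarrow> reachable H u w"
  using reachable_edge reachable_trans by metis

lemma reachable_sym: "reachable H u v \<longleftrightarrow> reachable H v u"
proof -
  have "sym {(a, b). {a, b} \<in> edges H}"
    by (auto simp: sym_def insert_commute)
  then show ?thesis
    unfolding reachable_def by (meson sym_rtrancl symE)
qed

lemma reachable_induct [consumes 1, case_names refl step]: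
  assumes "reachable H u v" "P u"
    and "\<And>v w. reachable H u v \<Longrightarrow> P v \<Longrightarrow> {v, w} \<in> edges H \<Longrightarrow> P w"
  shows "P v"
  using assms(1) unfolding reachable_def
proof (induction rule: rtrancl_induct)
  case (step y z)
  then show ?case
    using assms(3)[of y z] by (simp add: reachable_def)
qed (use assms in auto)

lemma reachable_mono: "reachable H u v \<Longrightarrow> edges H \<subseteq> edges H' \<Longrightarrow> reachable H' u v"
  by (induction rule: reachable_induct) (auto intro: reachable_step)

text \<open>A walk returning to a visited vertex is cut back to it. Paths are stored from their end,
  so that a step is a \<open>Cons\<close>.\<close>

lemma reachable_path:
  assumes "reachable H u v"
  obtains p where "p \<noteq> []" "hd p = v" "last p = u" "distinct p"
    "successively (\<lambda>a b. {a, b} \<in> edges H) p"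
  using assms
proof (induction arbitrary: thesis rule: reachable_induct)
  case refl
  show ?case
    by (rule refl[of "[u]"]) auto
next
  case (step v w)
  obtain p where p: "p \<noteq> []" "hd p = v" "last p = u" "distinct p"
    "successively (\<lambda>a b. {a, b} \<in> edges H) p"
    using step.IH by blast
  show ?case
  proof (cases "w \<in> set p")
    case True
    then obtain q r where qr: "p = q @ w # r"
      by (meson split_list)
    show ?thesis
      by (rule step.prems[of "w # r"]) (use p qr in \<open>auto simp: successively_append_iff\<close>)
  next
    case False
    show ?thesis
      by (rule step.prems[of "w # p"])
        (use p False step.hyps in \<open>auto simp: successively_Cons insert_commute\<close>)
  qed
qed

text \<open>The part of the tree beyond the edge as seen from i: the ordered pair orients the edge
  towards the side that is kept.\<close>

definition branch :: "'i ugraph \<Rightarrow> 'i \<Rightarrow> 'i \<Rightarrow> 'i set" where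
  "branch T i j = {a. reachable (delete_edge T {i, j}) j a}"

locale tree =
  fixes T :: "'i ugraph"
  assumes tree: "tree_graph T"

sublocale tree \<subseteq> conn_graph T
  by unfold_locales (use tree in \<open>simp add: tree_graph_def\<close>)

context tree
begin

lemma branch_self [simp]: "j \<in> branch T i j"
  by (simp add: branch_def)

text \<open>Acyclicity enters here: a path from j to i avoiding the edge would close up with it to a
  cycle.\<close>

lemma branch_origin:
  assumes ij: "{i, j} \<in> edges T"
  shows "i \<notin> branch T i j"
proof
  assume "i \<in> branch T i j"
  then obtain p where p: "p \<noteq> []" "hd p = i" "last p = j" "distinct p"
    "successively (\<lambda>a b. {a, b} \<in> edges T - {{i, j}}) p"
    unfolding branch_def using reachable_path[of "delete_edge T {i, j}" j i] by auto
  have "i \<noteq> j"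
    using edgeD[OF ij] by simp
  have nth: "{p ! k, p ! Suc k} \<in> edges T - {{i, j}}" if "Suc k < length p" for k
    using p(5) that by (simp add: successively_conv_nth)
  \<comment> \<open>Length 1 would force i = j, and length 2 would use the deleted edge; a cycle
    needs three vertices.\<close>
  have "length p \<noteq> 1"
    using p \<open>i \<noteq> j\<close> by (auto simp: length_Suc_conv)
  moreover have "length p \<noteq> 2"
    using p by (auto simp: numeral_2_eq_2 length_Suc_conv)
  moreover have "length p \<noteq> 0"
    using p by simp
  ultimately have "length p \<ge> 3"
    by linarith
  moreover have "{p ! k, p ! (Suc k mod length p)} \<in> edges T" if "k < length p" for k
  proof (cases "Suc k < length p")
    case True
    then show ?thesis
      using nth by simp
  next
    case False
    then have "Suc k = length p"
      using that by simp
    then have "p ! k = j" "p ! (Suc k mod length p) = i"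
      using p by (auto simp: last_conv_nth hd_conv_nth simp flip: \<open>Suc k = length p\<close>)
    then show ?thesis
      using ij by (simp add: insert_commute)
  qed
  ultimately have "is_cycle T p"
    using p by (simp add: is_cycle_def)
  then show False
    using tree by (auto simp: tree_graph_def)
qed

lemma branch_cong:
  assumes "{a, c} \<in> edges T" "{a, c} \<noteq> {i, j}"
  shows "a \<in> branch T i j \<longleftrightarrow> c \<in> branch T i j"
proof -
  have "{a, c} \<in> edges (delete_edge T {i, j})" "{c, a} \<in> edges (delete_edge T {i, j})"
    using assms by (auto simp: insert_commute)
  then show ?thesis
    unfolding branch_def by (blast intro: reachable_step)
qed

text \<open>The two sides cover the tree by connectedness, since crossing the edge lands on one of
  its ends; a common vertex would join i to j without the edge.\<close>

lemma branch_commute: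
  assumes ij: "{i, j} \<in> edges T" and a: "a \<in> verts T"
  shows "a \<in> branch T j i \<longleftrightarrow> a \<notin> branch T i j"
proof -
  have "reachable T i a"
    using edgeD[OF ij] a reachable by auto
  then have "a \<in> branch T j i \<or> a \<in> branch T i j"
  proof (induction rule: reachable_induct)
    case (step v w)
    show ?case
    proof (cases "{v, w} = {i, j}")
      case True
      then have "w = i \<or> w = j"
        by auto
      then show ?thesis
        by auto
    next
      case False
      then show ?thesis
        using step branch_cong[of v w i j] branch_cong[of v w j i]
        by (auto simp: insert_commute)
    qed
  qed auto
  moreover have "\<not> (a \<in> branch T j i \<and> a \<in> branch T i j)"
  proof
    assume "a \<in> branch T j i \<and> a \<in> branch T i j"
    then have "reachable (delete_edge T {i, j}) i a" "reachable (delete_edge T {i, j}) a j"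
      by (auto simp: branch_def insert_commute reachable_sym)
    then have "j \<in> branch T j i"
      by (auto simp: branch_def insert_commute intro: reachable_trans)
    then show False
      using branch_origin[of j i] ij by (simp add: insert_commute)
  qed
  ultimately show ?thesis
    by blast
qed

text \<open>A walk inside the branch at j never meets i, so it cannot use the edge {k, i} and stays
  on the side of i. Hence branches at distinct neighbours of i are disjoint.\<close>

lemma branch_disjoint:
  assumes "{i, j} \<in> edges T" "{i, k} \<in> edges T" "j \<noteq> k" "a \<in> branch T i j"
  shows "a \<in> branch T k i"
proof -
  have "reachable (delete_edge T {i, j}) j a"
    using assms(4) by (simp add: branch_def)
  then have "a \<in> branch T i j \<and> a \<in> branch T k i"
  proof (induction rule: reachable_induct)
    case refl
    have "{i, j} \<noteq> {k, i}"
      using assms(3) by (auto simp: doubleton_eq_iff)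
    from branch_cong[OF assms(1) this] show ?case
      by simp
  next
    case (step v w)
    have w: "w \<in> branch T i j"
      using branch_cong[of v w i j] step by auto
    then have "v \<noteq> i" "w \<noteq> i"
      using step.IH branch_origin[OF assms(1)] by auto
    then have "{v, w} \<noteq> {k, i}"
      by auto
    then show ?case
      using branch_cong[of v w k i] step w by auto
  qed
  then show ?thesis
    by simp
qed

lemma branch_ex1:
  assumes i: "i \<in> verts T" and a: "a \<in> verts T" "a \<noteq> i"
  shows "\<exists>!j. j \<in> neighbours T i \<and> a \<in> branch T i j"
proof (rule ex_ex1I)
  have "reachable T i a"
    using reachable i a by blast
  then have "a = i \<or> (\<exists>j. j \<in> neighbours T i \<and> a \<in> branch T i j)"
  proof (induction rule: reachable_induct)
    case (step v w)
    show ?case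
    proof (cases "v = i \<or> w = i")
      case True
      then show ?thesis
        using step by (auto simp: neighbours_def)
    next
      case False
      with step.IH obtain j where j: "j \<in> neighbours T i" "v \<in> branch T i j"
        by auto
      have "{v, w} \<noteq> {i, j}"
        using False by auto
      then show ?thesis
        using branch_cong[OF step.hyps(2)] j by auto
    qed
  qed auto
  then show "\<exists>j. j \<in> neighbours T i \<and> a \<in> branch T i j"
    using a by simp
next
  fix j k
  assume *: "j \<in> neighbours T i \<and> a \<in> branch T i j" "k \<in> neighbours T i \<and> a \<in> branch T i k"
  show "j = k"
  proof (rule ccontr)
    assume "j \<noteq> k"
    then have "a \<in> branch T k i"
      using * branch_disjoint by (auto simp: neighbours_def)
    then show False
      using * branch_commute[of i k a] a by (auto simp: neighbours_def)
  qed
qed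

text \<open>The vertex after i on the path to a, described by branches so that no paths need
  handling. For a = i no neighbour qualifies and the value is arbitrary.\<close>

definition toward :: "'i \<Rightarrow> 'i \<Rightarrow> 'i" where
  "toward i a = (THE j. j \<in> neighbours T i \<and> a \<in> branch T i j)"

lemma toward:
  assumes "i \<in> verts T" "a \<in> verts T" "a \<noteq> i"
  shows "toward i a \<in> neighbours T i" "a \<in> branch T i (toward i a)"
  using theI'[OF branch_ex1[OF assms]] by (simp_all add: toward_def)

lemma toward_eqI:
  assumes "j \<in> neighbours T i" "a \<in> branch T i j" "a \<in> verts T"
  shows "toward i a = j"
proof -
  have "i \<in> verts T" "a \<noteq> i"
    using assms edgeD branch_origin by (auto simp: neighbours_def)
  then show ?thesis
    unfolding toward_def using branch_ex1[of i a] assms by (intro the1_equality) auto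
qed

lemma toward_adjacent:
  assumes ac: "{a, c} \<in> edges T" and i: "i \<in> verts T" "i \<noteq> a" "i \<noteq> c"
  shows "toward i a = toward i c"
proof (rule toward_eqI)
  have c: "c \<in> verts T" "a \<in> verts T"
    using edgeD[OF ac] by auto
  show "toward i c \<in> neighbours T i"
    using toward c i by auto
  have "{a, c} \<noteq> {i, toward i c}"
    using i by auto
  then show "a \<in> branch T i (toward i c)"
    using branch_cong[OF ac] toward(2)[of i c] c i by auto
qed (use edgeD[OF ac] in auto)

end

context sgraph
begin

lemma sum_darts_swap:
  "(\<Sum>i\<in>verts H. \<Sum>j\<in>neighbours H i. f i j) = (\<Sum>i\<in>verts H. \<Sum>j\<in>neighbours H i. f j i)"
proof -
  have "(\<Sum>i\<in>verts H. \<Sum>j\<in>neighbours H i. f i j) =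
      (\<Sum>(i, j)\<in>(SIGMA i:verts H. neighbours H i). f i j)"
    by (simp add: sum.Sigma)
  also have "\<dots> = (\<Sum>(i, j)\<in>(SIGMA i:verts H. neighbours H i). f j i)"
    by (rule sum.reindex_bij_witness[of _ "\<lambda>(i, j). (j, i)" "\<lambda>(i, j). (j, i)"])
      (auto simp: neighbours_def insert_commute dest: edgeD)
  also have "\<dots> = (\<Sum>i\<in>verts H. \<Sum>j\<in>neighbours H i. f j i)"
    by (simp add: sum.Sigma)
  finally show ?thesis .
qed

end

context conn_graph
begin

text \<open>Half the difference of two columns of \<open>\<rho>\<close> is a potential for a unit current.\<close>

lemma resistance_eqI:
  assumes lap: "\<And>u v. u \<in> verts H \<Longrightarrow> v \<in> verts H \<Longrightarrow>
      lap H (\<lambda>w. \<rho> w v) u = c u - 2 * unit_vec v u"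
    and sym: "\<And>u v. u \<in> verts H \<Longrightarrow> v \<in> verts H \<Longrightarrow> \<rho> u v = \<rho> v u"
    and diag: "\<And>u. u \<in> verts H \<Longrightarrow> \<rho> u u = 0"
    and uv: "u \<in> verts H" "v \<in> verts H"
  shows "resistance H u v = \<rho> u v"
proof -
  have "lap H (\<lambda>w. 1 / 2 * (\<rho> w v - \<rho> w u)) x = unit_vec u x - unit_vec v x"
    if "x \<in> verts H" for x
    unfolding lap_cmult lap_diff using lap that uv by simp
  then have "resistance H u v = 1 / 2 * (\<rho> u v - \<rho> u u) - 1 / 2 * (\<rho> v v - \<rho> v u)"
    by (rule resistance_eq_potential[OF uv])
  then show ?thesis
    using sym diag uv by simp
qed

end

section \<open>Resistances in chains\<close>

locale chain =
  fixes T :: "'i ugraph"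
    and Gs :: "'i \<Rightarrow> 'a ugraph"
    and att :: "'i \<Rightarrow> 'i \<Rightarrow> 'a"
    and G :: "'a ugraph"
  assumes tree_T: "tree_graph T"
    and conn_Gs: "\<And>i. i \<in> verts T \<Longrightarrow> connected_graph (Gs i)"
    and chain: "is_chain T Gs att G"

sublocale chain \<subseteq> tree T
  by unfold_locales (rule tree_T)

section \<open>Structure of a chain\<close>

context chain
begin

lemma conn_graph_Gs: "i \<in> verts T \<Longrightarrow> conn_graph (Gs i)"
  by unfold_locales (rule conn_Gs)

lemma sgraph_Gs: "i \<in> verts T \<Longrightarrow> sgraph (Gs i)"
  by unfold_locales (use conn_Gs in \<open>simp add: connected_graph_def\<close>)

lemma nbr_verts: "j \<in> neighbours T i \<Longrightarrow> i \<in> verts T \<and> j \<in> verts T \<and> i \<noteq> j"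
  by (auto simp: neighbours_def dest: edgeD)

lemma att_verts: "j \<in> neighbours T i \<Longrightarrow> att i j \<in> verts (Gs i)"
  using chain by (simp add: is_chain_def neighbours_def)

lemma verts_G: "verts G = (\<Union>i\<in>verts T. verts (Gs i))"
  using chain by (simp add: is_chain_def)

definition bridge :: "'i \<Rightarrow> 'i \<Rightarrow> 'a set" where
  "bridge i j = {att i j, att j i}"

lemma bridge_commute: "bridge i j = bridge j i"
  by (auto simp: bridge_def)

lemma chain_bridges_eq: "chain_bridges T att = {bridge i j | i j. j \<in> neighbours T i}"
  by (auto simp: chain_bridges_def bridge_def neighbours_def)

lemma edges_G: "edges G = (\<Union>i\<in>verts T. edges (Gs i)) \<union> {bridge i j | i j. j \<in> neighbours T i}"
  using chain by (simp add: is_chain_def chain_bridges_eq)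

definition part :: "'a \<Rightarrow> 'i" where
  "part v = (THE j. j \<in> verts T \<and> v \<in> verts (Gs j))"

lemma part_eq: "i \<in> verts T \<Longrightarrow> v \<in> verts (Gs i) \<Longrightarrow> part v = i"
  unfolding part_def using chain
  by (intro the_equality) (auto simp: is_chain_def disjoint_family_on_def)

lemma part_of_eq: "part_of T Gs v = Gs (part v)"
  by (simp add: part_of_def part_def)

lemma part_verts: "v \<in> verts G \<Longrightarrow> part v \<in> verts T" "v \<in> verts G \<Longrightarrow> v \<in> verts (Gs (part v))"
  using part_eq by (auto simp: verts_G)

lemma part_att: "j \<in> neighbours T i \<Longrightarrow> part (att i j) = i"
  using att_verts nbr_verts part_eq by blast

lemma att_verts_G: "j \<in> neighbours T i \<Longrightarrow> att i j \<in> verts G"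
  using att_verts nbr_verts verts_G by blast

lemma att_neq: "j \<in> neighbours T i \<Longrightarrow> att i j \<noteq> att j i"
  using part_att nbr_verts neighbours_sym by metis

lemma Gs_edgeD:
  assumes "i \<in> verts T" "{v, w} \<in> edges (Gs i)"
  shows "v \<in> verts (Gs i)" "w \<in> verts (Gs i)" "part v = i" "part w = i" "v \<noteq> w"
  using sgraph.edgeD[OF sgraph_Gs[OF assms(1)] assms(2)] part_eq assms(1) by auto

lemma edge_G_cases:
  assumes "{v, w} \<in> edges G"
  obtains (inside) i where "i \<in> verts T" "{v, w} \<in> edges (Gs i)"
  | (bridge) i j where "j \<in> neighbours T i" "v = att i j" "w = att j i"
proof -
  consider i where "i \<in> verts T" "{v, w} \<in> edges (Gs i)"
    | i j where "j \<in> neighbours T i" "{v, w} = bridge i j"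
    using assms by (auto simp: edges_G)
  then show ?thesis
  proof cases
    case (2 i j)
    then consider "v = att i j" "w = att j i" | "v = att j i" "w = att i j"
      by (auto simp: bridge_def doubleton_eq_iff)
    then show ?thesis
      using bridge 2(1) neighbours_sym by (cases; metis)
  qed (use inside in blast)
qed

text \<open>Mapping the ends of a bridge to their parts recovers the tree edge, so bridges stay
  distinct even when they share an attachment vertex.\<close>

lemma bridge_eq_iff:
  assumes "j \<in> neighbours T i" "l \<in> neighbours T k"
  shows "bridge i j = bridge k l \<longleftrightarrow> {i, j} = {k, l}"
proof
  assume "bridge i j = bridge k l"
  then have "part ` bridge i j = part ` bridge k l"
    by simp
  then show "{i, j} = {k, l}"
    using assms neighbours_sym by (simp add: bridge_def part_att)
next
  assume "{i, j} = {k, l}"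
  then show "bridge i j = bridge k l"
    by (auto simp: doubleton_eq_iff bridge_commute)
qed

lemma simple_G: "simple_graph G"
proof -
  have "e \<in> {{u, v} | u v. u \<in> verts G \<and> v \<in> verts G \<and> u \<noteq> v}" if e: "e \<in> edges G" for e
  proof -
    consider i where "i \<in> verts T" "e \<in> edges (Gs i)"
      | i j where "j \<in> neighbours T i" "e = bridge i j"
      using e unfolding edges_G by blast
    then show ?thesis
    proof cases
      case (1 i)
      then obtain u v where "e = {u, v}" "u \<in> verts (Gs i)" "v \<in> verts (Gs i)" "u \<noteq> v"
        using sgraph.edgeE[OF sgraph_Gs] by metis
      then show ?thesis
        using 1 by (auto simp: verts_G)
    next
      case (2 i j)
      then show ?thesis
        using att_neq att_verts_G neighbours_sym unfolding bridge_def by blast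
    qed
  qed
  then show ?thesis
    using sgraph.finite_verts sgraph_Gs by (auto simp: simple_graph_def verts_G)
qed

text \<open>Kept general in T' and H to serve twice: for connectedness of G, and for the side of a
  bridge after its removal from both tree and chain.\<close>

lemma reachable_lift:
  assumes "reachable T' a c" "edges T' \<subseteq> edges T" "a \<in> verts T"
    and "\<And>i. i \<in> verts T \<Longrightarrow> edges (Gs i) \<subseteq> edges H"
    and "\<And>i j. {i, j} \<in> edges T' \<Longrightarrow> bridge i j \<in> edges H"
    and "u \<in> verts (Gs a)" "v \<in> verts (Gs c)"
  shows "reachable H u v"
proof -
  have inside: "reachable H x y" if "i \<in> verts T" "x \<in> verts (Gs i)" "y \<in> verts (Gs i)" for i x y
    by (rule reachable_mono[OF conn_graph.reachable[OF conn_graph_Gs] assms(4)]) (use that in auto)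
  have "c \<in> verts T \<and> (\<forall>v\<in>verts (Gs c). reachable H u v)"
    using assms(1)
  proof (induction rule: reachable_induct)
    case refl
    then show ?case
      using inside assms by blast
  next
    case (step c d)
    have cd: "d \<in> neighbours T c"
      using step.hyps(2) assms(2) by (auto simp: neighbours_def)
    then have d: "d \<in> verts T" "att c d \<in> verts (Gs c)" "att d c \<in> verts (Gs d)"
      using nbr_verts att_verts neighbours_sym by blast+
    have "reachable H u (att d c)"
      using step.IH d reachable_step[of H u "att c d" "att d c"] assms(5)[OF step.hyps(2)]
      by (simp add: bridge_def)
    then show ?case
      using inside d reachable_trans by metis
  qed
  then show ?thesis
    using assms by blast
qed

lemma connected_G: "connected_graph G"
proof -
  have "reachable G u v" if "u \<in> verts G" "v \<in> verts G" for u v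
  proof (rule reachable_lift)
    show "reachable T (part u) (part v)"
      using that part_verts reachable by blast
  qed (use that part_verts in \<open>auto simp: edges_G neighbours_def\<close>)
  moreover have "verts G \<noteq> {}"
    using verts_nonempty conn_graph.verts_nonempty[OF conn_graph_Gs] by (auto simp: verts_G)
  ultimately show ?thesis
    using simple_G by (simp add: connected_graph_def)
qed

sublocale G: conn_graph G
  by unfold_locales (rule connected_G)

lemma neighbours_G:
  assumes i: "i \<in> verts T" and v: "v \<in> verts (Gs i)"
  shows "neighbours G v = neighbours (Gs i) v \<union> (\<lambda>j. att j i) ` (neighbours T i \<inter> {j. att i j = v})"
proof (intro equalityI subsetI)
  fix w assume "w \<in> neighbours G v"
  then have "{v, w} \<in> edges G"
    by (simp add: neighbours_def)
  then show "w \<in> neighbours (Gs i) v \<union> (\<lambda>j. att j i) ` (neighbours T i \<inter> {j. att i j = v})"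
  proof (cases rule: edge_G_cases)
    case (inside k)
    then have "k = i"
      using Gs_edgeD(3)[OF inside] part_eq[OF i v] by simp
    then show ?thesis
      using inside by (simp add: neighbours_def)
  next
    case (bridge k l)
    then have "k = i"
      using part_att part_eq i v by metis
    then show ?thesis
      using bridge by auto
  qed
next
  fix w assume "w \<in> neighbours (Gs i) v \<union> (\<lambda>j. att j i) ` (neighbours T i \<inter> {j. att i j = v})"
  then show "w \<in> neighbours G v"
    using i by (auto simp: neighbours_def[of G] edges_G bridge_def neighbours_def[of "Gs i"])
qed

text \<open>Neighbours across different bridges lie in different parts, so nothing is counted twice
  even if several bridges start at v.\<close>

lemma sum_neighbours_G:
  fixes f :: "'a \<Rightarrow> real"
  assumes i: "i \<in> verts T" and v: "v \<in> verts (Gs i)"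
  shows "(\<Sum>w\<in>neighbours G v. f w) = (\<Sum>w\<in>neighbours (Gs i) v. f w) +
      (\<Sum>j\<in>neighbours T i. of_bool (att i j = v) * f (att j i))"
proof -
  have part: "part (att j i) = j" if "j \<in> neighbours T i" for j
    using part_att that neighbours_sym by blast
  have "neighbours (Gs i) v \<inter> (\<lambda>j. att j i) ` (neighbours T i \<inter> {j. att i j = v}) = {}"
    using Gs_edgeD[OF i] part nbr_verts by (fastforce simp: neighbours_def[of "Gs i"])
  moreover have "inj_on (\<lambda>j. att j i) (neighbours T i \<inter> {j. att i j = v})"
    by (rule inj_on_inverseI[of _ part]) (simp add: part)
  ultimately show ?thesis
    unfolding neighbours_G[OF i v]
    using sgraph.finite_neighbours[OF sgraph_Gs[OF i]]
    by (subst sum.union_disjoint) (simp_all add: sum.reindex)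
qed

lemma degree_G:
  assumes i: "i \<in> verts T" and v: "v \<in> verts (Gs i)"
  shows "real (degree G v) = real (degree (Gs i) v) + (\<Sum>j\<in>neighbours T i. of_bool (att i j = v))"
  using sum_neighbours_G[OF assms, of "\<lambda>_. 1"] by (simp add: degree_def)

text \<open>Every walk from \<open>v\<close> to the part \<open>i\<close> enters that part at \<open>gate i v\<close>.\<close>

definition gate :: "'i \<Rightarrow> 'a \<Rightarrow> 'a" where
  "gate i v = (if part v = i then v else att i (toward i (part v)))"

lemma gate_verts: "i \<in> verts T \<Longrightarrow> v \<in> verts G \<Longrightarrow> gate i v \<in> verts (Gs i)"
  using part_verts toward(1) att_verts by (auto simp: gate_def)

text \<open>Crossing a bridge at part i leads to or from its gate; crossing any other bridge stays
  within one branch at i.\<close>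

lemma gate_bridge:
  assumes i: "i \<in> verts T" and jk: "k \<in> neighbours T j"
  shows "gate i (att j k) = gate i (att k j)"
proof -
  have kj: "j \<in> neighbours T k"
    using jk neighbours_sym by blast
  consider "i = j" | "i = k" | "i \<noteq> j" "i \<noteq> k"
    by blast
  then show ?thesis
  proof cases
    case 1
    have "toward j k = k"
      using jk nbr_verts by (intro toward_eqI) auto
    then show ?thesis
      using 1 jk kj nbr_verts[OF jk] by (simp add: gate_def part_att)
  next
    case 2
    have "toward k j = j"
      using kj nbr_verts by (intro toward_eqI) auto
    then show ?thesis
      using 2 jk kj nbr_verts[OF jk] by (simp add: gate_def part_att)
  next
    case 3
    then show ?thesis
      using toward_adjacent[of j k i] i jk kj by (simp add: gate_def part_att neighbours_def)
  qed
qed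

lemma sum_toward:
  fixes f :: "'i \<Rightarrow> real"
  assumes i: "i \<in> verts T" and a: "a \<in> verts T"
  shows "(\<Sum>j\<in>neighbours T i. of_bool (a \<in> branch T i j) * f j) =
      (if a = i then 0 else f (toward i a))"
proof (cases "a = i")
  case True
  then show ?thesis
    using branch_origin by (auto simp: neighbours_def intro!: sum.neutral)
next
  case False
  have "neighbours T i \<inter> {j. a \<in> branch T i j} = {toward i a}"
    using toward[OF i a False] toward_eqI[OF _ _ a] by blast
  then show ?thesis
    using False by simp
qed

text \<open>The distance in T, as a count of separating edges. Only the orientation pointing towards
  a contributes, so each edge counts once.\<close>

definition separation :: "'i \<Rightarrow> 'i \<Rightarrow> real" where
  "separation a b = (\<Sum>i\<in>verts T. \<Sum>j\<in>neighbours T i.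
      of_bool (a \<in> branch T i j) * of_bool (b \<in> branch T j i))"

lemma separation_sym: "separation a b = separation b a"
  unfolding separation_def by (subst sum_darts_swap) (simp add: mult.commute)

lemma separation_self: "a \<in> verts T \<Longrightarrow> separation a a = 0"
  unfolding separation_def using branch_commute
  by (intro sum.neutral ballI) (auto simp: neighbours_def)

text \<open>Adjacent vertices of \<open>T\<close> are only distinguished by the branches of the edge joining them.\<close>

lemma separation_adjacent:
  assumes jl: "l \<in> neighbours T j" and b: "b \<in> verts T"
  shows "separation j b - separation l b = 2 * of_bool (b \<in> branch T j l) - 1"
proof -
  define d where "d i k = (of_bool (j \<in> branch T i k) - of_bool (l \<in> branch T i k)) *
      (of_bool (b \<in> branch T k i) :: real)" for i k
  have lj: "j \<in> neighbours T l" and e: "{j, l} \<in> edges T" "{l, j} \<in> edges T"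
    and v: "j \<in> verts T" "l \<in> verts T" "j \<noteq> l"
    using jl nbr_verts neighbours_sym by (auto simp: neighbours_def insert_commute)
  have "separation j b - separation l b = (\<Sum>i\<in>verts T. \<Sum>k\<in>neighbours T i. d i k)"
    by (simp only: separation_def d_def left_diff_distrib sum_subtractf)
  also have "\<dots> = (\<Sum>(i, k)\<in>(SIGMA i:verts T. neighbours T i). d i k)"
    by (simp add: sum.Sigma)
  also have "\<dots> = (\<Sum>(i, k)\<in>{(j, l), (l, j)}. d i k)"
  proof (intro sum.mono_neutral_right ballI)
    fix x assume x: "x \<in> (SIGMA i:verts T. neighbours T i) - {(j, l), (l, j)}"
    obtain i k where ik: "x = (i, k)"
      by fastforce
    then have "{j, l} \<noteq> {i, k}"
      using x by (auto simp: doubleton_eq_iff)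
    then show "(case x of (i, k) \<Rightarrow> d i k) = 0"
      using branch_cong[OF e(1)] by (simp add: ik d_def)
  qed (use jl lj v in auto)
  also have "\<dots> = d j l + d l j"
    using v by simp
  also have "\<dots> = 2 * of_bool (b \<in> branch T j l) - 1"
    using branch_origin e branch_commute[OF e(1) b] by (simp add: d_def)
  finally show ?thesis .
qed

definition chain_resistance :: "'a \<Rightarrow> 'a \<Rightarrow> real" where
  "chain_resistance u v =
    (\<Sum>i\<in>verts T. resistance (Gs i) (gate i u) (gate i v)) + separation (part u) (part v)"

text \<open>A step inside the part of u changes only the resistance term of that part, whose pole is
  the gate of v. A step across a bridge keeps all gates and changes only the separation, by 1 or -1.
  The bridge contribution moves the pole from the gate to v itself and leaves a term independent of
  v.\<close>

lemma lap_chain_resistance: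
  obtains c where "\<And>u v. u \<in> verts G \<Longrightarrow> v \<in> verts G \<Longrightarrow>
      lap G (\<lambda>w. chain_resistance w v) u = c u - 2 * unit_vec v u"
proof -
  have "\<exists>c. \<forall>u\<in>verts (Gs i). \<forall>v\<in>verts (Gs i).
      lap (Gs i) (\<lambda>w. resistance (Gs i) w v) u = c u - 2 * unit_vec v u" if "i \<in> verts T" for i
    using conn_graph.lap_resistance[OF conn_graph_Gs[OF that]] by metis
  then obtain c where c: "\<And>i u v. i \<in> verts T \<Longrightarrow> u \<in> verts (Gs i) \<Longrightarrow> v \<in> verts (Gs i) \<Longrightarrow>
      lap (Gs i) (\<lambda>w. resistance (Gs i) w v) u = c i u - 2 * unit_vec v u"
    by metis
  have "lap G (\<lambda>w. chain_resistance w v) u =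
      (c (part u) u - (\<Sum>l\<in>neighbours T (part u). of_bool (att (part u) l = u))) - 2 * unit_vec v u"
    if uv: "u \<in> verts G" "v \<in> verts G" for u v
  proof -
    define j where "j = part u"
    have j: "j \<in> verts T" "u \<in> verts (Gs j)"
      using part_verts uv by (auto simp: j_def)
    let ?r = "resistance (Gs j)"
    have inside: "chain_resistance u v - chain_resistance w v = ?r u (gate j v) - ?r w (gate j v)"
      if "w \<in> neighbours (Gs j) u" for w
    proof -
      have w: "part w = j"
        using Gs_edgeD[OF j(1)] that by (auto simp: neighbours_def)
      have "resistance (Gs i) (gate i u) (gate i v) - resistance (Gs i) (gate i w) (gate i v) =
          (if i = j then ?r u (gate j v) - ?r w (gate j v) else 0)" for i
        using w by (auto simp: gate_def j_def)
      then show ?thesis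
        using w j by (simp add: chain_resistance_def j_def flip: sum_subtractf)
    qed
    have across: "chain_resistance u v - chain_resistance (att l j) v =
        2 * of_bool (part v \<in> branch T j l) - 1" if l: "l \<in> neighbours T j" "att j l = u" for l
    proof -
      have "part (att l j) = l"
        using l neighbours_sym part_att by blast
      moreover have "gate i (att l j) = gate i u" if "i \<in> verts T" for i
        using gate_bridge[OF that l(1)] l(2) by simp
      ultimately show ?thesis
        using separation_adjacent[OF l(1)] part_verts uv
        by (simp add: chain_resistance_def flip: j_def)
    qed
    \<comment> \<open>Exactly one branch contains a v outside the part, and its attachment vertex is
      the gate of v; for v inside, the gate is v and both sides vanish.\<close>
    have entry: "(\<Sum>l\<in>neighbours T j. of_bool (att j l = u) * of_bool (part v \<in> branch T j l)) =
        (unit_vec (gate j v) u - unit_vec v u :: real)"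
      using sum_toward[OF j(1), of "part v" "\<lambda>l. of_bool (att j l = u)"] part_verts[OF uv(2)] j_def
      by (auto simp: gate_def unit_vec_def mult.commute)
    have "lap G (\<lambda>w. chain_resistance w v) u = lap (Gs j) (\<lambda>w. ?r w (gate j v)) u +
        (\<Sum>l\<in>neighbours T j. of_bool (att j l = u) * (2 * of_bool (part v \<in> branch T j l) - 1))"
      unfolding lap_def sum_neighbours_G[OF j]
      using inside across by (intro arg_cong2[where f = "(+)"] sum.cong) auto
    also have "(\<Sum>l\<in>neighbours T j. of_bool (att j l = u) * (2 * of_bool (part v \<in> branch T j l) - 1)) =
        2 * (unit_vec (gate j v) u - unit_vec v u) - (\<Sum>l\<in>neighbours T j. of_bool (att j l = u))"
      unfolding entry[symmetric] sum_distrib_left sum_subtractf[symmetric]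
      by (intro sum.cong refl) (simp add: algebra_simps)
    finally show ?thesis
      using c[OF j gate_verts[OF j(1) uv(2)]] by (simp flip: j_def)
  qed
  then show ?thesis
    by (rule that)
qed

lemma resistance_G:
  assumes "u \<in> verts G" "v \<in> verts G"
  shows "resistance G u v = chain_resistance u v"
proof -
  obtain c where c: "\<And>u v. u \<in> verts G \<Longrightarrow> v \<in> verts G \<Longrightarrow>
      lap G (\<lambda>w. chain_resistance w v) u = c u - 2 * unit_vec v u"
    using lap_chain_resistance by blast
  show ?thesis
  proof (rule G.resistance_eqI[OF c])
    show "chain_resistance u v = chain_resistance v u" if "u \<in> verts G" "v \<in> verts G" for u v
      unfolding chain_resistance_def using that
      by (auto simp: separation_sym[of "part u"] gate_verts
          intro!: sum.cong conn_graph.resistance_sym conn_graph_Gs)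
    show "chain_resistance u u = 0" if "u \<in> verts G" for u
      using that part_verts
      by (simp add: chain_resistance_def separation_self conn_graph.resistance_self conn_graph_Gs)
  qed (use assms in auto)
qed

end

section \<open>Kemeny's constant of a chain\<close>

context chain
begin

definition deg :: "'a \<Rightarrow> real" where
  "deg v = real (degree G v)"

definition vol :: "'i \<Rightarrow> 'i \<Rightarrow> real" where
  "vol i j = (\<Sum>v\<in>verts G. of_bool (part v \<in> branch T i j) * deg v)"

text \<open>Oriented like \<open>branch T i j\<close>: the end lies in part i, so the bridge and the
  edges on the side of j are counted.\<close>

definition bridge_weight :: "'i \<Rightarrow> 'i \<Rightarrow> real" where
  "bridge_weight i j = Wbar G (att i j, bridge i j)"

lemma sum_deg: "(\<Sum>v\<in>verts G. deg v) = 2 * real (num_edges G)"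
  using G.handshake unfolding deg_def of_nat_sum[symmetric] by simp

text \<open>A step in the chain stays in a part or follows a remaining tree edge; conversely walks
  in the tree lift. Components of G are thus read off from T.\<close>

lemma reachable_delete_bridge:
  assumes ij: "j \<in> neighbours T i" and v: "v \<in> verts G"
  shows "reachable (delete_edge G (bridge i j)) (att j i) v \<longleftrightarrow> part v \<in> branch T i j"
proof
  have ji: "i \<in> neighbours T j"
    using ij neighbours_sym by blast
  assume "reachable (delete_edge G (bridge i j)) (att j i) v"
  then show "part v \<in> branch T i j"
  proof (induction rule: reachable_induct)
    case refl
    then show ?case
      using ji by (simp add: part_att)
  next
    case (step v w)
    then have vw: "{v, w} \<in> edges G" "{v, w} \<noteq> bridge i j"
      by auto
    from vw(1) show ?case
    proof (cases rule: edge_G_cases)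
      case (inside k)
      then show ?thesis
        using Gs_edgeD[OF inside] step.IH by simp
    next
      case (bridge k l)
      then have "{k, l} \<in> edges T" "{k, l} \<noteq> {i, j}"
        using vw(2) bridge_eq_iff[OF bridge(1) ij] by (auto simp: neighbours_def bridge_def)
      moreover have "part v = k" "part w = l"
        using bridge part_att neighbours_sym by blast+
      ultimately show ?thesis
        using step.IH branch_cong by metis
    qed
  qed
next
  assume "part v \<in> branch T i j"
  then have "reachable (delete_edge T {i, j}) j (part v)"
    by (simp add: branch_def)
  then show "reachable (delete_edge G (bridge i j)) (att j i) v"
  proof (rule reachable_lift)
    show "edges (Gs k) \<subseteq> edges (delete_edge G (bridge i j))" if k: "k \<in> verts T" for k
    proof
      fix e assume e: "e \<in> edges (Gs k)"
      have "e \<noteq> bridge i j"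
      proof
        assume "e = bridge i j"
        then have "part (att i j) = part (att j i)"
          using Gs_edgeD[OF k, of "att i j" "att j i"] e by (simp add: bridge_def)
        then show False
          using ij part_att nbr_verts neighbours_sym by metis
      qed
      then show "e \<in> edges (delete_edge G (bridge i j))"
        using e k by (auto simp: edges_G)
    qed
    show "bridge k l \<in> edges (delete_edge G (bridge i j))"
      if kl: "{k, l} \<in> edges (delete_edge T {i, j})" for k l
    proof -
      have "l \<in> neighbours T k" "{k, l} \<noteq> {i, j}"
        using kl by (auto simp: neighbours_def)
      then show ?thesis
        using bridge_eq_iff[of l k j i] ij by (auto simp: edges_G)
    qed
    show "att j i \<in> verts (Gs j)"
      using ij att_verts neighbours_sym by blast
  qed (use ij nbr_verts part_verts v in auto)
qed

text \<open>The degree sum over a side of a bridge counts every edge inside twice and the bridge once.\<close>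

lemma vol_eq_W:
  assumes ij: "j \<in> neighbours T i"
  shows "vol i j = 2 * real (W G (att j i, bridge i j)) + 1"
proof -
  define C where "C = component_of (delete_edge G (bridge i j)) (att j i)"
  have ji: "i \<in> neighbours T j"
    using ij neighbours_sym by blast
  have verts_C: "verts C = {v \<in> verts G. part v \<in> branch T i j}"
    using reachable_delete_bridge[OF ij] by (auto simp: C_def component_of_def)
  have edges_C: "edges C = {e \<in> edges G - {bridge i j}. e \<subseteq> verts C}"
    using G.edge_subset by (auto simp: C_def component_of_def)
  interpret C: sgraph C
  proof
    have "finite (verts C)"
      by (simp add: verts_C)
    moreover have "e \<in> {{u, v} | u v. u \<in> verts C \<and> v \<in> verts C \<and> u \<noteq> v}" if e: "e \<in> edges C" for e
    proof -
      have "e \<in> edges G" "e \<subseteq> verts C"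
        using e by (auto simp: edges_C)
      then show ?thesis
        by (elim G.edgeE) blast
    qed
    ultimately show "simple_graph C"
      by (auto simp: simple_graph_def)
  qed
  have x: "att j i \<in> verts C" and y: "att i j \<notin> verts C"
    using att_verts_G[OF ji] branch_origin ij ji by (auto simp: verts_C part_att neighbours_def)
  \<comment> \<open>Any edge other than the bridge leads back into the component, so only the end of
    the bridge loses a neighbour.\<close>
  have nbr: "neighbours C v = neighbours G v - (if v = att j i then {att i j} else {})"
    if v: "v \<in> verts C" for v
  proof -
    have reach: "w \<in> verts C" if "{v, w} \<in> edges G" "{v, w} \<noteq> bridge i j" for w
    proof -
      have "w \<in> verts G"
        using G.edgeD[OF that(1)] by simp
      moreover have "reachable (delete_edge G (bridge i j)) (att j i) w"
        by (rule reachable_step[of _ _ v]) (use v that in \<open>simp_all add: C_def component_of_def\<close>)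
      ultimately show ?thesis
        using reachable_delete_bridge[OF ij] by (simp add: verts_C)
    qed
    have "{v, w} = bridge i j \<longleftrightarrow> v = att j i \<and> w = att i j" for w
      using v y by (auto simp: bridge_def doubleton_eq_iff)
    then show ?thesis
      using reach v by (auto simp: neighbours_def edges_C)
  qed
  have "att i j \<in> neighbours G (att j i)"
    using ij by (auto simp: neighbours_def[of G] edges_G bridge_def)
  then have degree_C: "deg v = real (degree C v) + of_bool (v = att j i)" if "v \<in> verts C" for v
    using nbr[OF that] card_Suc_Diff1[of "neighbours G v" "att i j"]
    by (auto simp: deg_def degree_def)
  have "vol i j = (\<Sum>v\<in>verts C. deg v)"
  proof -
    have "verts G \<inter> {v. part v \<in> branch T i j} = verts C"
      by (auto simp: verts_C)
    then show ?thesis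
      by (simp add: vol_def)
  qed
  also have "\<dots> = (\<Sum>v\<in>verts C. real (degree C v)) + (\<Sum>v\<in>verts C. of_bool (v = att j i))"
    unfolding sum.distrib[symmetric] by (intro sum.cong refl) (simp add: degree_C)
  also have "(\<Sum>v\<in>verts C. of_bool (v = att j i)) = (1 :: real)"
    using x by (simp add: of_bool_def)
  also have "(\<Sum>v\<in>verts C. real (degree C v)) = 2 * real (num_edges C)"
    using C.handshake unfolding of_nat_sum[symmetric] by simp
  finally show ?thesis
    by (simp add: W_def C_def)
qed

text \<open>The opposite side has degree sum 2W + 1, to be subtracted from 2m.\<close>

lemma vol_eq:
  assumes ij: "j \<in> neighbours T i"
  shows "vol i j = 2 * bridge_weight i j - 1"
proof -
  have ji: "i \<in> neighbours T j"
    using ij neighbours_sym by blast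
  have "of_bool (part v \<in> branch T i j) + of_bool (part v \<in> branch T j i) = (1 :: real)"
    if "v \<in> verts G" for v
    using branch_commute[of i j "part v"] ij part_verts(1)[OF that] by (auto simp: neighbours_def)
  then have "vol i j + vol j i = (\<Sum>v\<in>verts G. deg v)"
    unfolding vol_def sum.distrib[symmetric] distrib_right[symmetric] by (intro sum.cong) auto
  then show ?thesis
    using vol_eq_W[OF ji] by (simp add: sum_deg bridge_weight_def Wbar_def bridge_commute)
qed

text \<open>A branch beyond a bridge sends its whole degree sum, 2 Wbar - 1, to the attachment
  vertex. The missing 1 is the bridge itself, which adds one to the degree of that vertex in
  G.\<close>

lemma sum_gate:
  assumes i: "i \<in> verts T"
  shows "(\<Sum>v\<in>verts G. deg v * f (gate i v)) =
      (\<Sum>v\<in>verts (Gs i). degree_vec (Gs i) v * f v) +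
      (\<Sum>j\<in>neighbours T i. 2 * bridge_weight i j * f (att i j))"
proof -
  have "deg v * f (gate i v) = of_bool (part v = i) * deg v * f v +
      (\<Sum>j\<in>neighbours T i. of_bool (part v \<in> branch T i j) * (deg v * f (att i j)))"
    if "v \<in> verts G" for v
    using sum_toward[OF i part_verts(1)[OF that], of "\<lambda>j. deg v * f (att i j)"]
    by (simp add: gate_def)
  then have "(\<Sum>v\<in>verts G. deg v * f (gate i v)) =
      (\<Sum>v\<in>verts G. of_bool (part v = i) * (deg v * f v)) +
      (\<Sum>j\<in>neighbours T i. \<Sum>v\<in>verts G. of_bool (part v \<in> branch T i j) * (deg v * f (att i j)))"
    by (subst sum.swap) (simp add: sum.distrib mult.assoc)
  also have "(\<Sum>v\<in>verts G. of_bool (part v = i) * (deg v * f v)) =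
      (\<Sum>v\<in>verts (Gs i). deg v * f v)"
  proof -
    have "verts G \<inter> {v. part v = i} = verts (Gs i)"
      using i part_eq part_verts by (auto simp: verts_G)
    then show ?thesis
      by simp
  qed
  also have "\<dots> = (\<Sum>v\<in>verts (Gs i). degree_vec (Gs i) v * f v) +
      (\<Sum>v\<in>verts (Gs i). \<Sum>j\<in>neighbours T i. of_bool (att i j = v) * f v)"
    by (simp only: deg_def degree_vec_def degree_G[OF i] distrib_right sum.distrib
        sum_distrib_right cong: sum.cong)
  also have "(\<Sum>v\<in>verts (Gs i). \<Sum>j\<in>neighbours T i. of_bool (att i j = v) * f v) =
      (\<Sum>j\<in>neighbours T i. f (att i j))"
  proof (subst sum.swap, intro sum.cong refl)
    fix j assume j: "j \<in> neighbours T i"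
    have "verts (Gs i) \<inter> {v. att i j = v} = {att i j}"
      using att_verts[OF j] by auto
    then show "(\<Sum>v\<in>verts (Gs i). of_bool (att i j = v) * f v) = f (att i j)"
      using sgraph.finite_verts[OF sgraph_Gs[OF i]] by simp
  qed
  also have "(\<Sum>j\<in>neighbours T i. \<Sum>v\<in>verts G. of_bool (part v \<in> branch T i j) * (deg v * f (att i j))) =
      (\<Sum>j\<in>neighbours T i. vol i j * f (att i j))"
    by (simp only: vol_def sum_distrib_right mult.assoc)
  finally show ?thesis
    by (simp add: vol_eq left_diff_distrib sum_subtractf)
qed

lemma degree_resistance_eq:
  assumes i: "i \<in> verts T" and x: "x \<in> verts (Gs i)"
  shows "degree_resistance (Gs i) x = (\<Sum>u\<in>verts (Gs i). degree_vec (Gs i) u * resistance (Gs i) u x)"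
  using x sgraph.finite_verts[OF sgraph_Gs[OF i]]
  by (simp add: degree_resistance_def inner_on_def mat_vec_on_def sum_unit_vec)

text \<open>The common factor 4 arises three times: from the Kemeny term, from two equal cross terms
  with weight 2 Wbar, and from the product of two such weights.\<close>

lemma sum_gate_resistance:
  assumes i: "i \<in> verts T"
  shows "(\<Sum>u\<in>verts G. \<Sum>v\<in>verts G. deg u * deg v * resistance (Gs i) (gate i u) (gate i v)) =
      4 * (real (num_edges (Gs i)) * kemeny (Gs i)) +
      4 * (\<Sum>j\<in>neighbours T i. bridge_weight i j * degree_resistance (Gs i) (att i j)) +
      4 * (\<Sum>j\<in>neighbours T i. \<Sum>l\<in>neighbours T i.
        bridge_weight i j * bridge_weight i l * resistance (Gs i) (att i j) (att i l))"
proof -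
  interpret Gi: conn_graph "Gs i"
    by (rule conn_graph_Gs[OF i])
  let ?d = "degree_vec (Gs i)" and ?r = "resistance (Gs i)" and ?w = "bridge_weight i"
  let ?V = "verts (Gs i)" and ?N = "neighbours T i"
  \<comment> \<open>The potential of the pushed-forward measure; \<open>sum_gate\<close> is used in
    v to form it and in u to integrate it.\<close>
  define g where "g x = (\<Sum>v\<in>?V. ?d v * ?r x v) + (\<Sum>j\<in>?N. 2 * ?w j * ?r x (att i j))" for x
  have "(\<Sum>u\<in>verts G. \<Sum>v\<in>verts G. deg u * deg v * ?r (gate i u) (gate i v)) =
      (\<Sum>u\<in>verts G. deg u * g (gate i u))"
    unfolding g_def sum_gate[OF i, symmetric] by (simp add: sum_distrib_left mult.assoc)
  also have "\<dots> = (\<Sum>u\<in>?V. ?d u * g u) + (\<Sum>j\<in>?N. 2 * ?w j * g (att i j))"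
    by (rule sum_gate[OF i])
  also have "(\<Sum>u\<in>?V. ?d u * g u) =
      4 * (real (num_edges (Gs i)) * kemeny (Gs i)) +
      2 * (\<Sum>j\<in>?N. ?w j * degree_resistance (Gs i) (att i j))"
  proof -
    have "(\<Sum>u\<in>?V. ?d u * (\<Sum>j\<in>?N. 2 * ?w j * ?r u (att i j))) =
        (\<Sum>j\<in>?N. 2 * ?w j * (\<Sum>u\<in>?V. ?d u * ?r u (att i j)))"
      unfolding sum_distrib_left by (subst sum.swap) (simp add: mult_ac)
    also have "\<dots> = 2 * (\<Sum>j\<in>?N. ?w j * degree_resistance (Gs i) (att i j))"
      by (simp add: degree_resistance_eq[OF i] att_verts sum_distrib_left mult.assoc)
    finally have *: "(\<Sum>u\<in>?V. ?d u * (\<Sum>j\<in>?N. 2 * ?w j * ?r u (att i j))) =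
        2 * (\<Sum>j\<in>?N. ?w j * degree_resistance (Gs i) (att i j))" .
    have "4 * (real (num_edges (Gs i)) * kemeny (Gs i)) = (\<Sum>u\<in>?V. ?d u * (\<Sum>v\<in>?V. ?d v * ?r u v))"
      unfolding Gi.num_edges_kemeny
      by (simp add: degree_vec_def mult.assoc flip: sum_distrib_left)
    then show ?thesis
      unfolding * [symmetric] by (simp only: g_def distrib_left sum.distrib)
  qed
  also have "(\<Sum>j\<in>?N. 2 * ?w j * g (att i j)) =
      2 * (\<Sum>j\<in>?N. ?w j * degree_resistance (Gs i) (att i j)) +
      4 * (\<Sum>j\<in>?N. \<Sum>l\<in>?N. ?w j * ?w l * ?r (att i j) (att i l))"
  proof -
    have "(\<Sum>v\<in>?V. ?d v * ?r (att i j) v) = degree_resistance (Gs i) (att i j)" if "j \<in> ?N" for j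
      unfolding degree_resistance_eq[OF i att_verts[OF that]]
      by (intro sum.cong refl) (simp add: Gi.resistance_sym[of "att i j"] att_verts[OF that])
    then show ?thesis
      by (simp add: g_def distrib_left sum.distrib sum_distrib_left mult_ac)
  qed
  finally show ?thesis
    by simp
qed

text \<open>For a fixed oriented edge the two indicators depend on u and v separately, so the double
  sum factors.\<close>

lemma sum_separation:
  "(\<Sum>u\<in>verts G. \<Sum>v\<in>verts G. deg u * deg v * separation (part u) (part v)) =
    (\<Sum>i\<in>verts T. \<Sum>j\<in>neighbours T i. vol i j * vol j i)"
proof -
  let ?s = "\<lambda>i j u v. deg u * deg v *
      (of_bool (part u \<in> branch T i j) * of_bool (part v \<in> branch T j i))"
  \<comment> \<open>As a single sum over pairs its range is fixed and can be exchanged with the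
    vertex sums.\<close>
  have separation: "separation a b = (\<Sum>(i, j)\<in>(SIGMA i:verts T. neighbours T i).
      of_bool (a \<in> branch T i j) * of_bool (b \<in> branch T j i))" for a b
    unfolding separation_def by (rule sum.Sigma) auto
  have "(\<Sum>u\<in>verts G. \<Sum>v\<in>verts G. deg u * deg v * separation (part u) (part v)) =
      (\<Sum>u\<in>verts G. \<Sum>v\<in>verts G. \<Sum>(i, j)\<in>(SIGMA i:verts T. neighbours T i). ?s i j u v)"
    by (simp only: separation sum_distrib_left case_prod_unfold)
  also have "\<dots> = (\<Sum>(i, j)\<in>(SIGMA i:verts T. neighbours T i).
      \<Sum>u\<in>verts G. \<Sum>v\<in>verts G. ?s i j u v)"
    by (simp only: case_prod_unfold sum.swap[of _ "verts G" "Sigma _ _"])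
  also have "\<dots> = (\<Sum>(i, j)\<in>(SIGMA i:verts T. neighbours T i). vol i j * vol j i)"
    unfolding vol_def sum_product by (simp add: mult_ac)
  finally show ?thesis
    by (simp add: sum.Sigma)
qed

lemma kemeny_G:
  assumes "edges G \<noteq> {}"
  shows "real (num_edges G) * kemeny G =
      (\<Sum>i\<in>verts T. real (num_edges (Gs i)) * kemeny (Gs i)) +
      (\<Sum>i\<in>verts T. \<Sum>j\<in>neighbours T i. bridge_weight i j * degree_resistance (Gs i) (att i j)) +
      (\<Sum>i\<in>verts T. \<Sum>j\<in>neighbours T i. \<Sum>l\<in>neighbours T i.
        bridge_weight i j * bridge_weight i l * resistance (Gs i) (att i j) (att i l)) +
      (\<Sum>i\<in>verts T. \<Sum>j\<in>neighbours T i.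
        (2 * bridge_weight i j - 1) * (2 * bridge_weight j i - 1)) / 4"
proof -
  have "4 * (real (num_edges G) * kemeny G) =
      (\<Sum>u\<in>verts G. \<Sum>v\<in>verts G. deg u * deg v * chain_resistance u v)"
    unfolding G.num_edges_kemeny deg_def by (simp add: resistance_G)
  also have "\<dots> = (\<Sum>u\<in>verts G. \<Sum>v\<in>verts G. \<Sum>i\<in>verts T.
        deg u * deg v * resistance (Gs i) (gate i u) (gate i v)) +
      (\<Sum>u\<in>verts G. \<Sum>v\<in>verts G. deg u * deg v * separation (part u) (part v))"
    by (simp only: chain_resistance_def distrib_left sum.distrib sum_distrib_left)
  also have "(\<Sum>u\<in>verts G. \<Sum>v\<in>verts G. \<Sum>i\<in>verts T.
        deg u * deg v * resistance (Gs i) (gate i u) (gate i v)) =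
      (\<Sum>i\<in>verts T. \<Sum>u\<in>verts G. \<Sum>v\<in>verts G.
        deg u * deg v * resistance (Gs i) (gate i u) (gate i v))"
    by (simp only: sum.swap[of _ "verts G" "verts T"])
  also have "\<dots> = (\<Sum>i\<in>verts T.
      4 * (real (num_edges (Gs i)) * kemeny (Gs i)) +
      4 * (\<Sum>j\<in>neighbours T i. bridge_weight i j * degree_resistance (Gs i) (att i j)) +
      4 * (\<Sum>j\<in>neighbours T i. \<Sum>l\<in>neighbours T i.
        bridge_weight i j * bridge_weight i l * resistance (Gs i) (att i j) (att i l)))"
    by (intro sum.cong refl sum_gate_resistance)
  also have "(\<Sum>u\<in>verts G. \<Sum>v\<in>verts G. deg u * deg v * separation (part u) (part v)) =
      (\<Sum>i\<in>verts T. \<Sum>j\<in>neighbours T i.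
        (2 * bridge_weight i j - 1) * (2 * bridge_weight j i - 1))"
    unfolding sum_separation by (intro sum.cong refl) (metis vol_eq neighbours_sym)
  finally show ?thesis
    by (simp add: sum.distrib flip: sum_distrib_left)
qed

section \<open>From oriented tree edges to bridges and their ends\<close>

lemma sum_bridge_ends_darts:
  "(\<Sum>b\<in>chain_bridges T att. \<Sum>x\<in>b. f x b) =
    (\<Sum>i\<in>verts T. \<Sum>j\<in>neighbours T i. f (att i j) (bridge i j))"
proof -
  let ?D = "SIGMA i:verts T. neighbours T i"
  let ?h = "\<lambda>(i, j). (bridge i j, att i j)"
  have h: "inj_on ?h ?D"
  proof (rule inj_onI)
    fix p q assume pq: "p \<in> ?D" "q \<in> ?D" "?h p = ?h q"
    obtain i j k l where ij: "p = (i, j)" "q = (k, l)"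
      by fastforce
    then have "{i, j} = {k, l}" and eq: "att i j = att k l" "j \<in> neighbours T i" "l \<in> neighbours T k"
      using pq bridge_eq_iff by auto
    moreover have "i = k"
      using eq part_att by metis
    ultimately show "p = q"
      by (auto simp: ij doubleton_eq_iff)
  qed
  have bridges: "chain_bridges T att = (\<lambda>(i, j). bridge i j) ` ?D"
    using nbr_verts by (fastforce simp: chain_bridges_eq)
  have im: "?h ` ?D = (SIGMA b:chain_bridges T att. b)"
  proof (intro equalityI subsetI)
    fix p assume "p \<in> (SIGMA b:chain_bridges T att. b)"
    then obtain i j where ij: "j \<in> neighbours T i" "fst p = bridge i j" "snd p \<in> bridge i j"
      by (auto simp: chain_bridges_eq)
    then have "p = ?h (i, j) \<or> p = ?h (j, i)"
      by (cases p) (auto simp: bridge_def)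
    moreover have "(i, j) \<in> ?D" "(j, i) \<in> ?D"
      using ij nbr_verts neighbours_sym by auto
    ultimately show "p \<in> ?h ` ?D"
      by blast
  next
    fix p assume "p \<in> ?h ` ?D"
    then show "p \<in> (SIGMA b:chain_bridges T att. b)"
      by (auto simp: chain_bridges_eq bridge_def)
  qed
  have "(\<Sum>b\<in>chain_bridges T att. \<Sum>x\<in>b. f x b) =
      (\<Sum>(b, x)\<in>(SIGMA b:chain_bridges T att. b). f x b)"
    by (rule sum.Sigma) (auto simp: bridges bridge_def finite_SigmaI)
  also have "\<dots> = (\<Sum>(i, j)\<in>?D. f (att i j) (bridge i j))"
    unfolding im[symmetric] sum.reindex[OF h] by (simp add: case_prod_unfold)
  finally show ?thesis
    by (simp add: sum.Sigma)
qed

text \<open>Each bridge has two distinct ends, so its value can be shared equally between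
  them.\<close>

lemma sum_bridges_darts:
  "(\<Sum>b\<in>chain_bridges T att. f b) =
    (\<Sum>i\<in>verts T. \<Sum>j\<in>neighbours T i. f (bridge i j)) / (2 :: real)"
proof -
  have "f b = (\<Sum>x\<in>b. f b / 2)" if "b \<in> chain_bridges T att" for b
    using that att_neq by (auto simp: chain_bridges_eq bridge_def)
  then have "(\<Sum>b\<in>chain_bridges T att. f b) = (\<Sum>b\<in>chain_bridges T att. \<Sum>x\<in>b. f b / 2)"
    by (intro sum.cong) auto
  then show ?thesis
    unfolding sum_bridge_ends_darts by (simp add: sum_divide_distrib)
qed

lemma bridge_ends_eq:
  assumes i: "i \<in> verts T"
  shows "bridge_ends (chain_bridges T att) (Gs i) = (\<lambda>j. (att i j, bridge i j)) ` neighbours T i"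
proof (intro equalityI subsetI)
  fix p assume "p \<in> bridge_ends (chain_bridges T att) (Gs i)"
  then obtain k l where kl: "l \<in> neighbours T k" "snd p = bridge k l"
    and p: "fst p \<in> bridge k l" "fst p \<in> verts (Gs i)"
    by (auto simp: bridge_ends_def chain_bridges_eq)
  have lk: "k \<in> neighbours T l"
    using kl neighbours_sym by blast
  have "part (fst p) = i"
    using part_eq i p by blast
  moreover from p consider "fst p = att k l" | "fst p = att l k"
    by (auto simp: bridge_def)
  ultimately consider "fst p = att k l" "k = i" | "fst p = att l k" "l = i"
    using part_att kl lk by metis
  then show "p \<in> (\<lambda>j. (att i j, bridge i j)) ` neighbours T i"
  proof cases
    case 1
    then show ?thesis
      using kl by (intro image_eqI[of _ _ l]) (auto simp: prod_eq_iff)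
  next
    case 2
    then show ?thesis
      using kl lk by (intro image_eqI[of _ _ k]) (auto simp: prod_eq_iff bridge_commute)
  qed
qed (auto simp: bridge_ends_def chain_bridges_eq bridge_def att_verts)

lemma sum_bridge_ends:
  assumes i: "i \<in> verts T"
  shows "(\<Sum>(z1, z2)\<in>bridge_ends (chain_bridges T att) (Gs i) \<times> bridge_ends (chain_bridges T att) (Gs i).
      f z1 z2) =
    (\<Sum>j\<in>neighbours T i. \<Sum>l\<in>neighbours T i. f (att i j, bridge i j) (att i l, bridge i l))"
proof -
  have "inj_on (\<lambda>j. (att i j, bridge i j)) (neighbours T i)"
    using bridge_eq_iff by (intro inj_onI) (auto simp: doubleton_eq_iff)
  then show ?thesis
    unfolding bridge_ends_eq[OF i] by (simp add: sum.cartesian_product[symmetric] sum.reindex)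
qed

end

theorem theorem3p9:
  fixes k :: nat
    and T :: "nat ugraph"
    and Gs :: "nat \<Rightarrow> 'a ugraph"
    and att :: "nat \<Rightarrow> nat \<Rightarrow> 'a"
    and G :: "'a ugraph"
  defines "m \<equiv> real (num_edges G)"
    and "B \<equiv> chain_bridges T att"
  assumes tree: "tree_graph T" "verts T = {1..k}"
    and connected: "\<And>i. i \<in> {1..k} \<Longrightarrow> connected_graph (Gs i)"
    and chain: "is_chain T Gs att G"
    and nonempty: "edges G \<noteq> {}"
  shows "kemeny G =
      (\<Sum>i = 1..k. real (num_edges (Gs i)) / m * kemeny (Gs i))
    + (\<Sum>b \<in> B. \<Sum>x \<in> b. Wbar G (x, b) / m * degree_resistance (part_of T Gs x) x)
    + (\<Sum>i = 1..k. \<Sum>(z1, z2) \<in> bridge_ends B (Gs i) \<times> bridge_ends B (Gs i).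
         Wbar G z1 * Wbar G z2 / m * resistance (Gs i) (fst z1) (fst z2))
    + (\<Sum>b \<in> B. (\<Prod>x \<in> b. 2 * Wbar G (x, b) - 1) / (2 * m))"
proof -
  note verts_T = tree(2)
  interpret chain T Gs att G
    using tree connected chain by unfold_locales auto
  have m: "m \<noteq> 0"
    using nonempty by (simp add: m_def num_edges_def)
  have 1: "(\<Sum>i = 1..k. real (num_edges (Gs i)) / m * kemeny (Gs i)) =
      (\<Sum>i\<in>verts T. real (num_edges (Gs i)) * kemeny (Gs i)) / m"
    by (simp add: verts_T sum_divide_distrib)
  have 2: "(\<Sum>b\<in>B. \<Sum>x\<in>b. Wbar G (x, b) / m * degree_resistance (part_of T Gs x) x) =
      (\<Sum>i\<in>verts T. \<Sum>j\<in>neighbours T i. bridge_weight i j * degree_resistance (Gs i) (att i j)) / m"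
    unfolding B_def sum_bridge_ends_darts
    by (simp add: part_of_eq part_att bridge_weight_def sum_divide_distrib)
  have 3: "(\<Sum>i = 1..k. \<Sum>(z1, z2) \<in> bridge_ends B (Gs i) \<times> bridge_ends B (Gs i).
         Wbar G z1 * Wbar G z2 / m * resistance (Gs i) (fst z1) (fst z2)) =
      (\<Sum>i\<in>verts T. \<Sum>j\<in>neighbours T i. \<Sum>l\<in>neighbours T i.
        bridge_weight i j * bridge_weight i l * resistance (Gs i) (att i j) (att i l)) / m"
    unfolding B_def verts_T[symmetric]
    by (simp add: sum_bridge_ends bridge_weight_def sum_divide_distrib)
  \<comment> \<open>The denominator 4 combines the 2 of the claim with the two orientations of each
    bridge.\<close>
  have 4: "(\<Sum>b\<in>B. (\<Prod>x\<in>b. 2 * Wbar G (x, b) - 1) / (2 * m)) =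
      (\<Sum>i\<in>verts T. \<Sum>j\<in>neighbours T i.
        (2 * bridge_weight i j - 1) * (2 * bridge_weight j i - 1)) / 4 / m"
  proof -
    have "(\<Prod>x\<in>bridge i j. 2 * Wbar G (x, bridge i j) - 1) =
        (2 * bridge_weight i j - 1) * (2 * bridge_weight j i - 1)" if "j \<in> neighbours T i" for i j
      using att_neq[OF that] by (simp add: bridge_weight_def bridge_commute[of j i])
        (simp add: bridge_def)
    then show ?thesis
      unfolding B_def sum_bridges_darts by (simp add: sum_divide_distrib)
  qed
  have "kemeny G = m * kemeny G / m"
    using m by simp
  then show ?thesis
    unfolding 1 2 3 4 unfolding m_def kemeny_G[OF nonempty] add_divide_distrib .
qed

end
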